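(* Let $\mathcal S_n=(\mathcal V,(m_k)_{0\le k\le n})$ be a weighted $n$-simplicial (flag) complex, let $k\in\{0,\dots,n\}$, and let $D_k^{\downarrow},D_k^{\uparrow}\in[0,\infty]$ be the down/up degrees. Then, for all $u\in\mathcal C^k_c(\mathcal V)$, $$\langle \mathbb L_k^-u,u\rangle\le D_k^{\downarrow}\|u\|^2,\qquad \langle \mathbb L_k^+u,u\rangle\le D_k^{\uparrow}\|u\|^2,\qquad \langle\widetilde\Delta_k u,u\rangle\le (D_k^{\downarrow}+D_k^{\uparrow})\|u\|^2 .$$ Consequently, if $D_k^{\downarrow}+D_k^{\uparrow}<\infty$, then $\widetilde\Delta_k$ is bounded on the core $\mathcal C^k_c(\mathcal V)$ and extends uniquely to a bounded self-adjoint operator on (unweighted) $\ell^2$ with $$\|\widetilde\Delta_k\|\le D_k^{\downarrow}+D_k^{\uparrow}.$$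
   Context: Weighted graph: $\mathcal V$ is a countable set, $m_0:\mathcal V\to(0,\infty)$, and $m_1:\mathcal V^2\to[0,\infty)$ is symmetric and vanishes on the diagonal; $x\sim y$ (adjacent) iff $m_1(x,y)>0$, and $\mathcal N(x)=\{y:y\sim x\}$. No local finiteness is assumed. Weighted $n$-simplicial (flag) complex, $n\ge1$ fixed: $\mathcal F_k$ ($0\le k\le n$) is the set of ordered $(k+1)$-tuples of distinct pairwise adjacent vertices; $T_k$ (oriented $k$-simplices) is the set of classes $[x_0,\dots,x_k]$ of elements of $\mathcal F_k$ modulo even permutations; the unoriented simplex underlying $\sigma$ is $|\sigma|=\{x_0,\dots,x_k\}$. The weights $m_k:\mathcal V^{k+1}\to[0,\infty)$ are invariant under permutations of the arguments and positive exactly on $\mathcal F_k$ (so they are functions of unoriented simplices). For $(x_1,\dots,x_k)\in\mathcal F_{k-1}$, $F_{(x_1,\dots,x_k)}=\bigcap_j\mathcal N(x_j)$; it depends only on the unoriented simplex. Cochains: $\mathcal C^k(\mathcal V)$ is the space of $f:T_k\to\mathbb C$ with $f([x_{\pi(0)},\dots,x_{\pi(k)}])=\operatorname{sgn}(\pi)f([x_0,\dots,x_k])$ (arbitrary functions on $\mathcal V$ for $k=0$); $\mathcal C^k_c(\mathcal V)$ is the subspace of finitely supported ones. $\ell^2(m_k)$ is the Hilbert space of $k$-cochains with inner product $\langle f,g\rangle_k=\frac1{(k+1)!}\sum_{(x_0,\dots,x_k)\in\mathcal F_k}m_k(x_0,\dots,x_k)f([x_0,\dots,x_k])\overline{g([x_0,\dots,x_k])}$.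 Unweighted $\ell^2$ (in degree $k$) is the same with $m_k$ replaced by the constant $1$; its inner product and norm are written $\langle\cdot,\cdot\rangle,\|\cdot\|$. Operators: $d^kf([x_0,\dots,x_k])=\sum_{i=0}^k(-1)^if([x_0,\dots,\widehat{x_i},\dots,x_k])$ from $(k-1)$- to $k$-cochains, and $\delta^k$ is its formal adjoint, $\delta^kg([x_1,\dots,x_k])=\frac1{m_{k-1}(x_1,\dots,x_k)}\sum_{x_0\in F_{(x_1,\dots,x_k)}}m_k(x_0,x_1,\dots,x_k)g([x_0,x_1,\dots,x_k])$. Conventions: $\delta^0=0$, $d^{n+1}=0$. All formulas are read pointwise. $\mathbf L_k^-=d^k\delta^k$, $\mathbf L_k^+=\delta^{k+1}d^{k+1}$, and with $M_k$ denoting multiplication by $m_k$, $\mathbb L_k^{\pm}=M_k^{1/2}\mathbf L_k^{\pm}M_k^{-1/2}$, $\widetilde\Delta_k=\mathbb L_k^-+\mathbb L_k^+$, defined on $\mathcal C^k_c(\mathcal V)$ (pairing with a finitely supported cochain is a finite sum). Standing assumption: for every $0\le k\le n-1$ and every $k$-simplex $\sigma$, $\frac1{m_k(\sigma)}\sum_{w\in F_\sigma}m_{k+1}(\sigma,w)<\infty$. Degrees: $D_k^{\downarrow}=(k+1)\sup_{|\tau|}\frac1{m_{k-1}(|\tau|)}\sum_{z\in F_{|\tau|}}m_k(|\tau|,z)$ for $1\le k\le n$ (sup over unoriented $(k-1)$-simplices), $D_k^{\uparrow}=(k+2)\sup_{|\sigma|}\frac1{m_k(|\sigma|)}\sum_{z\in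 F_{|\sigma|}}m_{k+1}(|\sigma|,z)$ for $0\le k\le n-1$ (sup over unoriented $k$-simplices), and $D_0^{\downarrow}=0$, $D_n^{\uparrow}=0$. *)

theory Defs
  imports "HOL-Analysis.Analysis" "HOL-Combinatorics.Combinatorics"
begin

(* Ordered tuples (x_0,...,x_k) are lists of length k+1.  A family of weights is
   m :: nat => 'v list => real, where m k is the weight m_k on V^(k+1); values of
   m k on other lists are irrelevant. *)

definition nbrs :: "'v set \<Rightarrow> (nat \<Rightarrow> 'v list \<Rightarrow> real) \<Rightarrow> 'v \<Rightarrow> 'v set" where
  "nbrs V m x = {y \<in> V. m 1 [x, y] > 0}"

definition ordered_simplices :: "'v set \<Rightarrow> (nat \<Rightarrow> 'v list \<Rightarrow> real) \<Rightarrow> nat \<Rightarrow> 'v list set" where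
  "ordered_simplices V m k =
     {xs. length xs = k + 1 \<and> set xs \<subseteq> V \<and> distinct xs \<and>
          pairwise (\<lambda>x y. y \<in> nbrs V m x) (set xs)}"

definition common_nbrs :: "'v set \<Rightarrow> (nat \<Rightarrow> 'v list \<Rightarrow> real) \<Rightarrow> 'v list \<Rightarrow> 'v set" where
  "common_nbrs V m xs = (\<Inter>x\<in>set xs. nbrs V m x)"

(* The degree 0 and degree 1 instances of weight_pos and weight_perm say that
   m_0 > 0 on V and that m_1 is symmetric and vanishes on the diagonal. *)
locale weighted_flag_complex =
  fixes V :: "'v set" and n :: nat and m :: "nat \<Rightarrow> 'v list \<Rightarrow> real"
  assumes countable_V: "countable V"
    and n_ge_1: "n \<ge> 1"
    and weight_nonneg:
      "\<And>k xs. k \<le> n \<Longrightarrow> length xs = k + 1 \<Longrightarrow> set xs \<subseteq> V \<Longrightarrow> m k xs \<ge> 0"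
    and weight_pos:
      "\<And>k xs. k \<le> n \<Longrightarrow> length xs = k + 1 \<Longrightarrow> set xs \<subseteq> V \<Longrightarrow>
         m k xs > 0 \<longleftrightarrow> xs \<in> ordered_simplices V m k"
    and weight_perm:
      "\<And>k xs p. k \<le> n \<Longrightarrow> length xs = k + 1 \<Longrightarrow> set xs \<subseteq> V \<Longrightarrow> p permutes {..<k + 1} \<Longrightarrow>
         m k (permute_list p xs) = m k xs"
    and weight_summable:
      "\<And>k xs. k < n \<Longrightarrow> xs \<in> ordered_simplices V m k \<Longrightarrow>
         (\<lambda>w. m (k + 1) (xs @ [w])) summable_on common_nbrs V m xs"

definition oriented :: "'v list \<Rightarrow> 'v list set" where
  "oriented xs = {permute_list p xs |p. p permutes {..<length xs} \<and> evenperm p}"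

definition oriented_simplices :: "'v set \<Rightarrow> (nat \<Rightarrow> 'v list \<Rightarrow> real) \<Rightarrow> nat \<Rightarrow> 'v list set set" where
  "oriented_simplices V m k = oriented ` ordered_simplices V m k"

definition rep :: "'v list set \<Rightarrow> 'v list" where
  "rep \<sigma> = (SOME xs. xs \<in> \<sigma>)"

(* A function on T_k is encoded as a total function that is 0 outside T_k. *)
definition cochains :: "'v set \<Rightarrow> (nat \<Rightarrow> 'v list \<Rightarrow> real) \<Rightarrow> nat \<Rightarrow> ('v list set \<Rightarrow> complex) set" where
  "cochains V m k =
     {f. (\<forall>\<sigma>. \<sigma> \<notin> oriented_simplices V m k \<longrightarrow> f \<sigma> = 0) \<and>
         (\<forall>xs\<in>ordered_simplices V m k. \<forall>p. p permutes {..<k + 1} \<longrightarrow>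
            f (oriented (permute_list p xs)) = of_int (sign p) * f (oriented xs))}"

definition cochains_fin :: "'v set \<Rightarrow> (nat \<Rightarrow> 'v list \<Rightarrow> real) \<Rightarrow> nat \<Rightarrow> ('v list set \<Rightarrow> complex) set" where
  "cochains_fin V m k = {f \<in> cochains V m k. finite {\<sigma> \<in> oriented_simplices V m k. f \<sigma> \<noteq> 0}}"

definition l2_space :: "'v set \<Rightarrow> (nat \<Rightarrow> 'v list \<Rightarrow> real) \<Rightarrow> nat \<Rightarrow> ('v list set \<Rightarrow> complex) set" where
  "l2_space V m k =
     {f \<in> cochains V m k.
        (\<lambda>xs. (cmod (f (oriented xs)))\<^sup>2) summable_on ordered_simplices V m k}"

definition l2_inner ::
  "'v set \<Rightarrow> (nat \<Rightarrow> 'v list \<Rightarrow> real) \<Rightarrow> nat \<Rightarrow> ('v list set \<Rightarrow> complex) \<Rightarrow> ('v list set \<Rightarrow> complex) \<Rightarrow> complex" where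
  "l2_inner V m k f g =
     1 / fact (k + 1) *
     (\<Sum>\<^sub>\<infinity>xs\<in>ordered_simplices V m k. f (oriented xs) * cnj (g (oriented xs)))"

definition l2_norm ::
  "'v set \<Rightarrow> (nat \<Rightarrow> 'v list \<Rightarrow> real) \<Rightarrow> nat \<Rightarrow> ('v list set \<Rightarrow> complex) \<Rightarrow> real" where
  "l2_norm V m k f = sqrt (Re (l2_inner V m k f f))"

(* d^k, from (k-1)- to k-cochains, with d^(n+1) = 0.  On alternating arguments the value
   does not depend on the representative; the same holds for delta and mult_weight. *)
definition coboundary ::
  "'v set \<Rightarrow> nat \<Rightarrow> (nat \<Rightarrow> 'v list \<Rightarrow> real) \<Rightarrow> nat \<Rightarrow> ('v list set \<Rightarrow> complex) \<Rightarrow> 'v list set \<Rightarrow> complex" where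
  "coboundary V n m k f \<sigma> =
     (if k \<le> n \<and> \<sigma> \<in> oriented_simplices V m k
      then \<Sum>i\<le>k. (-1) ^ i * f (oriented (take i (rep \<sigma>) @ drop (Suc i) (rep \<sigma>)))
      else 0)"

(* delta^k, from k- to (k-1)-cochains, with delta^0 = 0. *)
definition delta ::
  "'v set \<Rightarrow> (nat \<Rightarrow> 'v list \<Rightarrow> real) \<Rightarrow> nat \<Rightarrow> ('v list set \<Rightarrow> complex) \<Rightarrow> 'v list set \<Rightarrow> complex" where
  "delta V m k g \<tau> =
     (if k \<ge> 1 \<and> \<tau> \<in> oriented_simplices V m (k - 1)
      then 1 / complex_of_real (m (k - 1) (rep \<tau>)) *
           (\<Sum>\<^sub>\<infinity>x\<in>common_nbrs V m (rep \<tau>).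
              complex_of_real (m k (x # rep \<tau>)) * g (oriented (x # rep \<tau>)))
      else 0)"

(* M_k^a *)
definition mult_weight ::
  "(nat \<Rightarrow> 'v list \<Rightarrow> real) \<Rightarrow> nat \<Rightarrow> real \<Rightarrow> ('v list set \<Rightarrow> complex) \<Rightarrow> 'v list set \<Rightarrow> complex" where
  "mult_weight m k a f \<sigma> = complex_of_real (m k (rep \<sigma>) powr a) * f \<sigma>"

definition L_down ::
  "'v set \<Rightarrow> nat \<Rightarrow> (nat \<Rightarrow> 'v list \<Rightarrow> real) \<Rightarrow> nat \<Rightarrow> ('v list set \<Rightarrow> complex) \<Rightarrow> 'v list set \<Rightarrow> complex" where
  "L_down V n m k f = coboundary V n m k (delta V m k f)"

definition L_up ::
  "'v set \<Rightarrow> nat \<Rightarrow> (nat \<Rightarrow> 'v list \<Rightarrow> real) \<Rightarrow> nat \<Rightarrow> ('v list set \<Rightarrow> complex) \<Rightarrow> 'v list set \<Rightarrow> complex" where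
  "L_up V n m k f = delta V m (k + 1) (coboundary V n m (k + 1) f)"

definition LL_down ::
  "'v set \<Rightarrow> nat \<Rightarrow> (nat \<Rightarrow> 'v list \<Rightarrow> real) \<Rightarrow> nat \<Rightarrow> ('v list set \<Rightarrow> complex) \<Rightarrow> 'v list set \<Rightarrow> complex" where
  "LL_down V n m k u = mult_weight m k (1/2) (L_down V n m k (mult_weight m k (-1/2) u))"

definition LL_up ::
  "'v set \<Rightarrow> nat \<Rightarrow> (nat \<Rightarrow> 'v list \<Rightarrow> real) \<Rightarrow> nat \<Rightarrow> ('v list set \<Rightarrow> complex) \<Rightarrow> 'v list set \<Rightarrow> complex" where
  "LL_up V n m k u = mult_weight m k (1/2) (L_up V n m k (mult_weight m k (-1/2) u))"

definition Delta_tilde ::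
  "'v set \<Rightarrow> nat \<Rightarrow> (nat \<Rightarrow> 'v list \<Rightarrow> real) \<Rightarrow> nat \<Rightarrow> ('v list set \<Rightarrow> complex) \<Rightarrow> 'v list set \<Rightarrow> complex" where
  "Delta_tilde V n m k u = (\<lambda>\<sigma>. LL_down V n m k u \<sigma> + LL_up V n m k u \<sigma>)"

(* The suprema run over ordered representatives of the unoriented simplices; by
   permutation invariance this does not change them.  In ennreal, Sup {} = 0. *)
definition deg_down :: "'v set \<Rightarrow> (nat \<Rightarrow> 'v list \<Rightarrow> real) \<Rightarrow> nat \<Rightarrow> ennreal" where
  "deg_down V m k =
     (if k = 0 then 0
      else of_nat (k + 1) *
        (SUP \<tau>\<in>ordered_simplices V m (k - 1).
           (\<Sum>\<^sub>\<infinity>z\<in>common_nbrs V m \<tau>. ennreal (m k (\<tau> @ [z]))) / ennreal (m (k - 1) \<tau>)))"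

definition deg_up :: "'v set \<Rightarrow> nat \<Rightarrow> (nat \<Rightarrow> 'v list \<Rightarrow> real) \<Rightarrow> nat \<Rightarrow> ennreal" where
  "deg_up V n m k =
     (if k \<ge> n then 0
      else of_nat (k + 2) *
        (SUP \<sigma>\<in>ordered_simplices V m k.
           (\<Sum>\<^sub>\<infinity>z\<in>common_nbrs V m \<sigma>. ennreal (m (k + 1) (\<sigma> @ [z]))) / ennreal (m k \<sigma>)))"

(* Everywhere defined bounded linear operators on the unweighted l^2 space. *)
definition l2_bounded_op ::
  "'v set \<Rightarrow> (nat \<Rightarrow> 'v list \<Rightarrow> real) \<Rightarrow> nat \<Rightarrow> (('v list set \<Rightarrow> complex) \<Rightarrow> 'v list set \<Rightarrow> complex) \<Rightarrow> bool" where
  "l2_bounded_op V m k A \<longleftrightarrow>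
     (\<forall>f\<in>l2_space V m k. A f \<in> l2_space V m k) \<and>
     (\<forall>f\<in>l2_space V m k. \<forall>g\<in>l2_space V m k. \<forall>a b.
        A (\<lambda>\<sigma>. a * f \<sigma> + b * g \<sigma>) = (\<lambda>\<sigma>. a * A f \<sigma> + b * A g \<sigma>)) \<and>
     (\<exists>C. \<forall>f\<in>l2_space V m k. l2_norm V m k (A f) \<le> C * l2_norm V m k f)"

definition l2_self_adjoint ::
  "'v set \<Rightarrow> (nat \<Rightarrow> 'v list \<Rightarrow> real) \<Rightarrow> nat \<Rightarrow> (('v list set \<Rightarrow> complex) \<Rightarrow> 'v list set \<Rightarrow> complex) \<Rightarrow> bool" where
  "l2_self_adjoint V m k A \<longleftrightarrow>
     (\<forall>f\<in>l2_space V m k. \<forall>g\<in>l2_space V m k. l2_inner V m k (A f) g = l2_inner V m k f (A g))"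

(* A real supremum, meaningful for operators satisfying l2_bounded_op. *)
definition l2_op_norm ::
  "'v set \<Rightarrow> (nat \<Rightarrow> 'v list \<Rightarrow> real) \<Rightarrow> nat \<Rightarrow> (('v list set \<Rightarrow> complex) \<Rightarrow> 'v list set \<Rightarrow> complex) \<Rightarrow> real" where
  "l2_op_norm V m k A = (SUP f\<in>{f \<in> l2_space V m k. l2_norm V m k f \<le> 1}. l2_norm V m k (A f))"

end

theory Submission imports Defs begin

text \<open>
  Conjugating by the square roots of the weights turns the coboundary between degrees \<open>r\<close> and
  \<open>r + 1\<close> into an operator \<open>T\<close> (\<open>wcoboundary r\<close>) between the unweighted spaces, and the codifferential
  into its adjoint \<open>T\<^sup>*\<close> (\<open>wdelta r\<close>). The lower Laplacian in degree \<open>r + 1\<close> is then \<open>T T\<^sup>*\<close> and the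
  upper Laplacian in degree \<open>r\<close> is \<open>T\<^sup>* T\<close>, so that their quadratic forms are \<open>\<parallel>T\<^sup>* u\<parallel>\<^sup>2\<close> and \<open>\<parallel>T u\<parallel>\<^sup>2\<close>.
  Since the lower degree in \<open>r + 1\<close> and the upper degree in \<open>r\<close> are the same number \<open>D\<close>, everything
  comes down to the two estimates \<open>\<parallel>T f\<parallel>\<^sup>2 \<le> D \<parallel>f\<parallel>\<^sup>2\<close> and \<open>\<parallel>T\<^sup>* g\<parallel>\<^sup>2 \<le> D \<parallel>g\<parallel>\<^sup>2\<close>
  (\<open>wcoboundary_norm\<close>, \<open>wdelta_norm\<close>). Both are Cauchy-Schwarz: the first on the \<open>r + 2\<close> faces of a simplex,
  the second on the vertices that extend a simplex; the weights of all the extensions of a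
  simplex \<open>ys\<close> add up to at most \<open>D / (r + 2)\<close> times the weight of \<open>ys\<close>.

  For finite degrees both operators are given by their pointwise formulas on all of
  \<open>\<ell>\<^sup>2\<close>, the sums being absolutely convergent. So \<open>Delta_tilde\<close> itself, read on \<open>\<ell>\<^sup>2\<close>, is the
  required extension: it is bounded by the triangle inequality and self-adjoint because
  \<open>T\<close> and \<open>T\<^sup>*\<close> are adjoint, and it is the only extension because finitely supported cochains
  are dense. For infinite degrees the bounds on the forms are void, but the forms still have to be
  real. This needs adjointness for an unbounded \<open>T\<close>, and \<open>adjoint\<close> is therefore proved for
  every \<open>f\<close> whose face terms are square summable. A finitely supported \<open>f\<close> is of this kind because
  the extensions of a single simplex have finite total weight.

  Sums run over ordered simplices. An ordered \<open>(r + 1)\<close>-simplex is an ordered \<open>r\<close>-simplex with one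
  common neighbour in front; removing the \<open>i\<close>-th vertex is moving it to the front, at the cost of the
  sign \<open>(-1)\<^sup>i\<close>, and then dropping it. Hence all the faces of a simplex contribute equally
  to a sum over all ordered simplices, which is the source of the factors \<open>r + 2\<close>.
  That \<open>T f\<close> and \<open>T\<^sup>* g\<close> are alternating is checked on swaps of adjacent vertices only, which generate
  all permutations.
\<close>

section \<open>Alternating functions of lists\<close>

abbreviation omit :: "nat \<Rightarrow> 'a list \<Rightarrow> 'a list" where
  "omit i xs \<equiv> take i xs @ drop (Suc i) xs"

definition to_front :: "nat \<Rightarrow> 'a list \<Rightarrow> 'a list" where
  "to_front i xs = xs ! i # omit i xs"

lemma mset_to_front: "i < length xs \<Longrightarrow> mset (to_front i xs) = mset xs"
  using arg_cong[OF id_take_nth_drop[of i xs], of mset] by (simp add: to_front_def)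

lemma tl_to_front [simp]: "tl (to_front i xs) = omit i xs"
  by (simp add: to_front_def)

text \<open>
  Sums over ordered simplices may thus be taken after moving the \<open>i\<close>-th vertex to the front, which
  replaces the \<open>i\<close>-th face by the tail. The inverse puts the head back at position \<open>i\<close>.
\<close>
lemma bij_to_front:
  assumes closed: "\<And>xs ys. xs \<in> S \<Longrightarrow> mset ys = mset xs \<Longrightarrow> ys \<in> S"
    and len: "\<And>xs. xs \<in> S \<Longrightarrow> i < length xs"
  shows "bij_betw (to_front i) S S"
proof (rule bij_betwI[where g = "\<lambda>ys. take i (tl ys) @ hd ys # drop i (tl ys)"])
  show "to_front i \<in> S \<rightarrow> S"
    using closed len mset_to_front by blast
  show "(\<lambda>ys. take i (tl ys) @ hd ys # drop i (tl ys)) \<in> S \<rightarrow> S"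
  proof
    fix ys assume ys: "ys \<in> S"
    then have "ys \<noteq> []" using len by fastforce
    then obtain y zs where "ys = y # zs" by (cases ys) auto
    moreover have "mset (take i zs) + mset (drop i zs) = mset zs"
      by (metis append_take_drop_id mset_append)
    ultimately show "take i (tl ys) @ hd ys # drop i (tl ys) \<in> S"
      using ys by (intro closed[OF ys]) auto
  qed
  show "take i (tl (to_front i xs)) @ hd (to_front i xs) # drop i (tl (to_front i xs)) = xs"
    if "xs \<in> S" for xs
    using len[OF that] by (simp add: to_front_def id_take_nth_drop[symmetric] min_def)
  show "to_front i (take i (tl ys) @ hd ys # drop i (tl ys)) = ys" if "ys \<in> S" for ys
    using len[OF that] by (cases ys) (simp_all add: to_front_def nth_append min_def)
qed

lemma permute_list_transpose:
  assumes "a < b" "b < length xs"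
  obtains as x bs y cs where "xs = as @ x # bs @ y # cs"
    "permute_list (Transposition.transpose a b) xs = as @ y # bs @ x # cs"
proof -
  let ?as = "take a xs" and ?bs = "drop (Suc a) (take b xs)" and ?cs = "drop (Suc b) xs"
  have take: "take b xs = ?as @ xs ! a # ?bs"
    using assms by (subst id_take_nth_drop[of a]) (auto simp: min_def)
  have xs: "xs = ?as @ xs ! a # ?bs @ xs ! b # ?cs"
    by (subst id_take_nth_drop[OF assms(2)], subst take) simp
  have p: "Transposition.transpose a b permutes {..<length xs}"
    using assms by (intro permutes_swap_id) auto
  have "permute_list (Transposition.transpose a b) xs = xs[a := xs ! b, b := xs ! a]"
    using assms by (intro nth_equalityI)
      (auto simp: permute_list_nth[OF p] nth_list_update Transposition.transpose_def)
  also have "\<dots> = ?as @ xs ! b # ?bs @ xs ! a # ?cs"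
  proof -
    have "(as @ x # bs @ y # cs)[length as := v, Suc (length as + length bs) := w] = as @ v # bs @ w # cs"
      for as bs cs :: "'a list" and x y v w
      by (simp add: list_update_append)
    from this[of ?as "xs ! a" ?bs "xs ! b" ?cs "xs ! b" "xs ! a"] show ?thesis
      using assms xs by (simp add: min_def)
  qed
  finally show ?thesis
    using xs that by blast
qed

text \<open>
  Only swaps of adjacent entries are required: they can be checked on list patterns, without
  permutations of indices. The full sign rule follows in \<open>alternating_permute\<close>.
\<close>
definition alternating_on :: "'v list set \<Rightarrow> ('v list \<Rightarrow> complex) \<Rightarrow> bool" where
  "alternating_on S G \<longleftrightarrow>
     (\<forall>as x y bs. as @ x # y # bs \<in> S \<longrightarrow> G (as @ y # x # bs) = - G (as @ x # y # bs))"

lemma alternating_onD: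
  "alternating_on S G \<Longrightarrow> as @ x # y # bs \<in> S \<Longrightarrow> G (as @ y # x # bs) = - G (as @ x # y # bs)"
  unfolding alternating_on_def by blast

locale permutation_closed =
  fixes S :: "'v list set"
  assumes closed: "\<And>xs ys. xs \<in> S \<Longrightarrow> mset ys = mset xs \<Longrightarrow> ys \<in> S"
begin

lemma alternating_move:
  assumes alt: "alternating_on S G"
  shows "as @ x # bs @ cs \<in> S \<Longrightarrow> G (as @ bs @ x # cs) = (-1) ^ length bs * G (as @ x # bs @ cs)"
proof (induction bs arbitrary: as)
  case (Cons b bs)
  have "as @ b # x # bs @ cs \<in> S"
    by (rule closed[OF Cons.prems]) auto
  with Cons.IH[of "as @ [b]"]
  have "G (as @ b # bs @ x # cs) = (-1) ^ length bs * G (as @ b # x # bs @ cs)" by simp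
  also have "G (as @ b # x # bs @ cs) = - G (as @ x # b # bs @ cs)"
    by (rule alternating_onD[OF alt]) (use Cons.prems in simp)
  finally show ?case by simp
qed simp

lemma alternating_to_front:
  assumes "alternating_on S G" "xs \<in> S" "i < length xs"
  shows "G (to_front i xs) = (-1) ^ i * G xs"
proof -
  have xs: "xs = take i xs @ xs ! i # drop (Suc i) xs"
    using assms(3) by (rule id_take_nth_drop)
  have "to_front i xs \<in> S"
    using assms mset_to_front closed by blast
  then have "G xs = (-1) ^ i * G (to_front i xs)"
    using alternating_move[OF assms(1), of "[]" "xs ! i" "take i xs" "drop (Suc i) xs"] assms(3) xs
    by (simp add: to_front_def min_def)
  then show ?thesis
    by (simp flip: power_add mult_2 mult.assoc)
qed

text \<open>
  Exchanging two entries at distance \<open>length bs + 1\<close> moves each of them across \<open>bs\<close>, where the signs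
  cancel, and swaps them once when they are adjacent.
\<close>
lemma alternating_swap:
  assumes alt: "alternating_on S G" and mem: "as @ x # bs @ y # cs \<in> S"
  shows "G (as @ y # bs @ x # cs) = - G (as @ x # bs @ y # cs)"
proof -
  have m: "as @ x # y # bs @ cs \<in> S" "as @ y # x # bs @ cs \<in> S" "as @ x # bs @ y # cs \<in> S"
    "as @ y # bs @ x # cs \<in> S" "as @ bs @ x # y # cs \<in> S"
    by (rule closed[OF mem]; simp)+
  have "G (as @ bs @ x # y # cs) = (-1) ^ length bs * G (as @ x # bs @ y # cs)"
    using alternating_move[OF alt, of as x bs "y # cs"] m by simp
  moreover have "G (as @ bs @ y # x # cs) = (-1) ^ length bs * G (as @ y # bs @ x # cs)"
    using alternating_move[OF alt, of as y bs "x # cs"] m by simp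
  moreover have "G (as @ bs @ y # x # cs) = - G (as @ bs @ x # y # cs)"
    using alternating_onD[OF alt, of "as @ bs" x y cs] m by simp
  ultimately have "(-1) ^ length bs * (G (as @ y # bs @ x # cs) + G (as @ x # bs @ y # cs)) = 0"
    unfolding distrib_left by (metis add.left_inverse)
  then show ?thesis
    by (simp add: eq_neg_iff_add_eq_0)
qed

text \<open>
  Every permutation is a product of transpositions, and each transposition changes the sign.
\<close>
lemma alternating_permute:
  assumes alt: "alternating_on S G" and xs: "xs \<in> S" and p: "p permutes {..<length xs}"
  shows "G (permute_list p xs) = of_int (sign p) * G xs"
proof -
  have transp: "G (permute_list (Transposition.transpose a b) xs) = - G xs"
    if "a < length xs" "b < length xs" "a \<noteq> b" "xs \<in> S" for a b xs
  proof -
    from \<open>a \<noteq> b\<close> consider "a < b" | "b < a" by (rule linorder_neqE_nat)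
    then show ?thesis
    proof cases
      case 1
      then show ?thesis
        using that alternating_swap[OF alt] permute_list_transpose[of a b xs] by metis
    next
      case 2
      then show ?thesis
        using that alternating_swap[OF alt] permute_list_transpose[of b a xs]
        by (metis transpose_commute)
    qed
  qed
  have "\<forall>xs\<in>S. length xs = n \<longrightarrow> G (permute_list p xs) = of_int (sign p) * G xs"
    if "p permutes {..<n}" for p n
    using that finite_lessThan
  proof (induction rule: permutes_induct)
    case (swap a b p)
    show ?case
    proof (intro ballI impI)
      fix xs assume xs: "xs \<in> S" "length xs = n"
      let ?t = "Transposition.transpose a b"
      have t: "?t permutes {..<length xs}"
        using swap xs by (intro permutes_swap_id) auto
      then have "permute_list ?t xs \<in> S"
        by (intro closed[OF xs(1)]) simp
      moreover have "permute_list (?t \<circ> p) xs = permute_list p (permute_list ?t xs)"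
        using swap xs by (intro permute_list_compose) auto
      ultimately have "G (permute_list (?t \<circ> p) xs) = of_int (sign p) * G (permute_list ?t xs)"
        using swap xs by simp
      moreover have "G (permute_list ?t xs) = - G xs"
        using swap xs by (intro transp) auto
      moreover have "sign (?t \<circ> p) = - sign p"
        using swap
        by (subst sign_compose)
           (auto simp: permutation_swap_id sign_swap_id intro: permutes_imp_permutation[rotated])
      ultimately show "G (permute_list (?t \<circ> p) xs) = of_int (sign (?t \<circ> p)) * G xs"
        by simp
    qed
  qed auto
  with xs p show ?thesis by blast
qed

lemma alternating_on_if_permute:
  assumes perm: "\<And>xs p. xs \<in> S \<Longrightarrow> p permutes {..<length xs} \<Longrightarrow>
    G (permute_list p xs) = of_int (sign p) * G xs"
  shows "alternating_on S G"
  unfolding alternating_on_def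
proof (intro allI impI)
  fix as x y bs assume mem: "as @ x # y # bs \<in> S"
  let ?xs = "as @ x # y # bs" and ?t = "Transposition.transpose (length as) (Suc (length as))"
  have t: "?t permutes {..<length ?xs}"
    by (intro permutes_swap_id) auto
  have "permute_list ?t ?xs = as @ y # x # bs"
    by (intro nth_equalityI)
      (auto simp: permute_list_nth[OF t] nth_append nth_Cons Transposition.transpose_def split: nat.split)
  then show "G (as @ y # x # bs) = - G ?xs"
    using perm[OF mem t] by (simp add: sign_swap_id)
qed

end

lemma in_oriented: "xs \<in> oriented xs"
  unfolding oriented_def by (auto intro!: exI[of _ id] simp: permutes_id)

lemma finite_oriented: "finite (oriented xs)"
proof -
  have "oriented xs \<subseteq> (\<lambda>p. permute_list p xs) ` {p. p permutes {..<length xs}}"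
    by (auto simp: oriented_def)
  then show ?thesis
    using finite_permutations finite_subset by blast
qed

lemma oriented_permute:
  assumes "p permutes {..<length xs}" "evenperm p"
  shows "oriented (permute_list p xs) = oriented xs"
proof -
  have sub: "oriented (permute_list p xs) \<subseteq> oriented xs"
    if p: "p permutes {..<length xs}" "evenperm p" for p and xs :: "'a list"
  proof
    fix zs assume "zs \<in> oriented (permute_list p xs)"
    then obtain q where q: "zs = permute_list q (permute_list p xs)"
      "q permutes {..<length xs}" "evenperm q"
      by (auto simp: oriented_def)
    then have "zs = permute_list (p \<circ> q) xs"
      by (simp add: permute_list_compose)
    moreover have "evenperm (p \<circ> q)"
      using p q by (subst evenperm_comp) (auto intro: permutes_imp_permutation[rotated])
    ultimately show "zs \<in> oriented xs"
      using p q permutes_compose unfolding oriented_def by blast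
  qed
  have "permute_list (inv p) (permute_list p xs) = permute_list (p \<circ> inv p) xs"
    using permutes_inv[OF assms(1)] by (simp add: permute_list_compose)
  also have "\<dots> = xs"
    using permutes_inv_o[OF assms(1)] by simp
  finally have "oriented xs \<subseteq> oriented (permute_list p xs)"
    using sub[of "inv p" "permute_list p xs"] permutes_inv[OF assms(1)] assms(2)
      evenperm_inv[OF permutes_imp_permutation[OF _ assms(1)]] by simp
  with sub[OF assms] show ?thesis by blast
qed

lemma rep_oriented:
  obtains p where "p permutes {..<length xs}" "evenperm p" "rep (oriented xs) = permute_list p xs"
proof -
  have "rep (oriented xs) \<in> oriented xs"
    unfolding rep_def by (rule someI) (rule in_oriented)
  then show ?thesis using that by (auto simp: oriented_def)
qed

lemma mset_rep_oriented: "mset (rep (oriented xs)) = mset xs"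
  using rep_oriented[of xs] by (metis mset_permute_list)

lemma oriented_rep_oriented: "oriented (rep (oriented xs)) = oriented xs"
  using rep_oriented[of xs] oriented_permute by metis

text \<open>
  The operators on cochains evaluate at the chosen representative of a class. By this lemma, any other
  representative may be used for a formula that is alternating.
\<close>
lemma (in permutation_closed) alternating_rep:
  assumes "alternating_on S G" "xs \<in> S"
  shows "G (rep (oriented xs)) = G xs"
proof -
  obtain p where p: "p permutes {..<length xs}" "evenperm p" "rep (oriented xs) = permute_list p xs"
    by (rule rep_oriented)
  then show ?thesis
    using alternating_permute[OF assms p(1)] by (simp add: sign_def)
qed

section \<open>Square summable families\<close>

definition square_summable_on :: "('a \<Rightarrow> complex) \<Rightarrow> 'a set \<Rightarrow> bool" (infixr "square'_summable'_on" 46) where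
  "a square_summable_on S \<longleftrightarrow> (\<lambda>x. (cmod (a x))\<^sup>2) summable_on S"

lemma L2_set_le_sqrt_infsum:
  assumes "a square_summable_on S" "finite X" "X \<subseteq> S"
  shows "L2_set (\<lambda>x. cmod (a x)) X \<le> sqrt (\<Sum>\<^sub>\<infinity>x\<in>S. (cmod (a x))\<^sup>2)"
  unfolding L2_set_def using assms
  by (intro real_sqrt_le_mono finite_sum_le_infsum) (auto simp: square_summable_on_def)

lemma
  fixes a :: "'a \<Rightarrow> real"
  assumes nonneg: "\<And>x. x \<in> S \<Longrightarrow> 0 \<le> a x"
    and le: "\<And>X. finite X \<Longrightarrow> X \<subseteq> S \<Longrightarrow> sum a X \<le> c"
  shows summable_on_if_sums_le: "a summable_on S"
    and infsum_le_if_sums_le: "infsum a S \<le> c"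
proof -
  show "a summable_on S"
    by (rule nonneg_bdd_above_summable_on) (use nonneg le in \<open>auto intro!: bdd_aboveI\<close>)
  then show "infsum a S \<le> c"
    by (rule infsum_le_finite_sums) (use le in auto)
qed

lemma
  assumes a: "a square_summable_on S" and b: "b square_summable_on S"
  shows square_summable_mult: "(\<lambda>x. cmod (a x * b x)) summable_on S"
    and infsum_Cauchy_Schwarz:
      "(\<Sum>\<^sub>\<infinity>x\<in>S. cmod (a x * b x))
         \<le> sqrt (\<Sum>\<^sub>\<infinity>x\<in>S. (cmod (a x))\<^sup>2) * sqrt (\<Sum>\<^sub>\<infinity>x\<in>S. (cmod (b x))\<^sup>2)" (is "_ \<le> ?c")
proof -
  have le: "(\<Sum>x\<in>X. cmod (a x * b x)) \<le> ?c" if "finite X" "X \<subseteq> S" for X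
  proof -
    have "(\<Sum>x\<in>X. cmod (a x * b x)) \<le> L2_set (\<lambda>x. cmod (a x)) X * L2_set (\<lambda>x. cmod (b x)) X"
      using L2_set_mult_ineq[of "\<lambda>x. cmod (a x)" "\<lambda>x. cmod (b x)" X] by (simp add: norm_mult)
    also have "\<dots> \<le> ?c"
      using that by (intro mult_mono L2_set_le_sqrt_infsum a b) (auto simp: infsum_nonneg)
    finally show ?thesis .
  qed
  show "(\<lambda>x. cmod (a x * b x)) summable_on S"
    by (rule summable_on_if_sums_le[OF _ le]) auto
  show "(\<Sum>\<^sub>\<infinity>x\<in>S. cmod (a x * b x)) \<le> ?c"
    by (rule infsum_le_if_sums_le[OF _ le]) auto
qed

lemma
  assumes a: "a square_summable_on S" and b: "b square_summable_on S"
  shows square_summable_add: "(\<lambda>x. a x + b x) square_summable_on S"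
    and infsum_Minkowski:
      "sqrt (\<Sum>\<^sub>\<infinity>x\<in>S. (cmod (a x + b x))\<^sup>2)
         \<le> sqrt (\<Sum>\<^sub>\<infinity>x\<in>S. (cmod (a x))\<^sup>2) + sqrt (\<Sum>\<^sub>\<infinity>x\<in>S. (cmod (b x))\<^sup>2)" (is "_ \<le> ?c")
proof -
  have c: "0 \<le> ?c" by (simp add: infsum_nonneg)
  have le: "(\<Sum>x\<in>X. (cmod (a x + b x))\<^sup>2) \<le> ?c\<^sup>2" if "finite X" "X \<subseteq> S" for X
  proof -
    have "L2_set (\<lambda>x. cmod (a x + b x)) X \<le> L2_set (\<lambda>x. cmod (a x) + cmod (b x)) X"
      by (intro L2_set_mono norm_triangle_ineq) auto
    also have "\<dots> \<le> L2_set (\<lambda>x. cmod (a x)) X + L2_set (\<lambda>x. cmod (b x)) X"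
      by (rule L2_set_triangle_ineq)
    also have "\<dots> \<le> ?c"
      using that by (intro add_mono L2_set_le_sqrt_infsum a b)
    finally have "sqrt (\<Sum>x\<in>X. (cmod (a x + b x))\<^sup>2) \<le> ?c"
      unfolding L2_set_def .
    then show ?thesis by (rule sqrt_le_D)
  qed
  show "(\<lambda>x. a x + b x) square_summable_on S"
    unfolding square_summable_on_def by (rule summable_on_if_sums_le[OF _ le]) auto
  have "(\<Sum>\<^sub>\<infinity>x\<in>S. (cmod (a x + b x))\<^sup>2) \<le> ?c\<^sup>2"
    by (rule infsum_le_if_sums_le[OF _ le]) auto
  with c show "sqrt (\<Sum>\<^sub>\<infinity>x\<in>S. (cmod (a x + b x))\<^sup>2) \<le> ?c"
    by (rule real_le_lsqrt)
qed

lemma square_summable_scale: "a square_summable_on S \<Longrightarrow> (\<lambda>x. c * a x) square_summable_on S"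
  unfolding square_summable_on_def norm_mult power_mult_distrib by (rule summable_on_cmult_right)

lemma square_summable_sum:
  assumes "finite I" "\<And>i. i \<in> I \<Longrightarrow> a i square_summable_on S"
  shows "(\<lambda>x. \<Sum>i\<in>I. a i x) square_summable_on S"
  using assms
proof (induction I rule: finite_induct)
  case empty
  then show ?case by (simp add: square_summable_on_def)
next
  case (insert i I)
  then show ?case using square_summable_add[of "a i" S "\<lambda>x. \<Sum>i\<in>I. a i x"] by simp
qed

text \<open>Transfers the degrees, which are suprema of sums in \<^typ>\<open>ennreal\<close>, to sums of real weights.\<close>
lemma infsum_ennreal_eq:
  fixes f :: "'a \<Rightarrow> real"
  assumes "f summable_on S" "\<And>x. x \<in> S \<Longrightarrow> 0 \<le> f x"
  shows "(\<Sum>\<^sub>\<infinity>x\<in>S. ennreal (f x)) = ennreal (infsum f S)"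
proof -
  have "(\<Sum>\<^sub>\<infinity>x\<in>S. ennreal (f x)) = (SUP X\<in>{X. finite X \<and> X \<subseteq> S}. \<Sum>x\<in>X. ennreal (f x))"
    by (rule nonneg_infsum_complete) simp
  also have "\<dots> = (SUP X\<in>{X. finite X \<and> X \<subseteq> S}. ennreal (sum f X))"
    using assms(2) by (intro SUP_cong refl sum_ennreal) auto
  finally show ?thesis
    using infsum_nonneg_is_SUPREMUM_ennreal[OF assms] by simp
qed

lemma finite_sum_has_sum:
  fixes \<phi> :: "'i \<Rightarrow> 'x \<Rightarrow> 'c::topological_comm_monoid_add"
  assumes "finite I" "\<And>i. i \<in> I \<Longrightarrow> (\<phi> i has_sum c i) S"
  shows "((\<lambda>x. \<Sum>i\<in>I. \<phi> i x) has_sum (\<Sum>i\<in>I. c i)) S"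
  using assms by (induction I rule: finite_induct) (auto intro: has_sum_add)

lemma
  fixes \<phi> :: "'i \<Rightarrow> 'x \<Rightarrow> 'c::{topological_comm_monoid_add, t2_space}"
  assumes "finite I" "\<And>i. i \<in> I \<Longrightarrow> \<phi> i summable_on S"
  shows infsum_finite_sum: "(\<Sum>\<^sub>\<infinity>x\<in>S. \<Sum>i\<in>I. \<phi> i x) = (\<Sum>i\<in>I. infsum (\<phi> i) S)"
    and summable_on_finite_sum: "(\<lambda>x. \<Sum>i\<in>I. \<phi> i x) summable_on S"
  using finite_sum_has_sum[OF assms(1), of \<phi> S "\<lambda>i. infsum (\<phi> i) S"] assms(2)
  by (auto simp: has_sum_iff)

lemma fact_Suc_Suc: "(fact (Suc r + 1) :: real) = real (r + 2) * fact (r + 1)"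
  by (simp add: fact_Suc)

lemma powr_minus_half: "0 \<le> w \<Longrightarrow> w powr - (1/2) = 1 / sqrt w" for w :: real
  by (simp add: powr_minus_divide powr_half_sqrt)

text \<open>
  The passage from the bounds \<open>\<surd>D\<close> on \<open>T\<close> and \<open>T\<^sup>*\<close> to the bound \<open>D\<close> on their compositions.
\<close>
lemma norm_le_if_factor:
  fixes a b c D :: real
  assumes "a\<^sup>2 \<le> D * b\<^sup>2" "b\<^sup>2 \<le> D * c\<^sup>2" "0 \<le> D" "0 \<le> c"
  shows "a \<le> D * c"
proof (rule power2_le_imp_le)
  have "a\<^sup>2 \<le> D * (D * c\<^sup>2)"
    using assms by (meson mult_left_mono order.trans)
  then show "a\<^sup>2 \<le> (D * c)\<^sup>2"
    by (simp add: power_mult_distrib power2_eq_square mult_ac)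
qed (use assms in simp)

section \<open>Ordered simplices and cochains\<close>

context weighted_flag_complex
begin

abbreviation "F k \<equiv> ordered_simplices V m k"

lemma nbrs_sym:
  assumes "x \<in> V" "y \<in> nbrs V m x"
  shows "x \<in> nbrs V m y"
proof -
  have p: "Transposition.transpose 0 1 permutes {..<1 + 1::nat}"
    by (intro permutes_swap_id) auto
  have "m 1 (permute_list (Transposition.transpose 0 1) [x, y]) = m 1 [x, y]"
    by (rule weight_perm[OF n_ge_1 _ _ p]) (use assms in \<open>auto simp: nbrs_def\<close>)
  moreover have "permute_list (Transposition.transpose 0 1) [x, y] = [y, x]"
    by (simp add: permute_list_def Transposition.transpose_def)
  ultimately show ?thesis using assms by (auto simp: nbrs_def)
qed

lemma not_in_own_nbrs: "x \<notin> nbrs V m x"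
proof
  assume "x \<in> nbrs V m x"
  then have "[x, x] \<in> F 1"
    using weight_pos[OF n_ge_1, of "[x, x]"] by (auto simp: nbrs_def)
  then show False by (simp add: ordered_simplices_def)
qed

lemma in_simplices_mset:
  assumes "xs \<in> F k" "mset ys = mset xs"
  shows "ys \<in> F k"
  using assms mset_eq_length[OF assms(2)] mset_eq_setD[OF assms(2)] mset_eq_imp_distinct_iff[OF assms(2)]
  by (auto simp: ordered_simplices_def)

sublocale simplices: permutation_closed "F k" for k
  by unfold_locales (rule in_simplices_mset)

lemma length_simplex: "xs \<in> F k \<Longrightarrow> length xs = Suc k"
  by (simp add: ordered_simplices_def)

lemma weight_mset:
  assumes "xs \<in> F k" "k \<le> n" "mset ys = mset xs"
  shows "m k ys = m k xs"
proof -
  obtain p where p: "p permutes {..<length xs}" "permute_list p xs = ys"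
    using mset_eq_permutation[OF assms(3)] by blast
  with assms show ?thesis
    using weight_perm[of k xs p] by (auto simp: ordered_simplices_def)
qed

lemma weight_positive: "xs \<in> F k \<Longrightarrow> k \<le> n \<Longrightarrow> 0 < m k xs"
  using weight_pos[of k xs] by (auto simp: ordered_simplices_def)

text \<open>
  In a flag complex a simplex can be extended exactly by the common neighbours of its vertices.
  A common neighbour is never one of these vertices because no vertex is its own neighbour.
\<close>
lemma Cons_in_simplices_iff: "x # ys \<in> F (Suc r) \<longleftrightarrow> ys \<in> F r \<and> x \<in> common_nbrs V m ys"
proof -
  have "x \<notin> set ys" "x \<in> V" if "x \<in> common_nbrs V m ys" "ys \<in> F r"
  proof -
    show "x \<notin> set ys" using that not_in_own_nbrs by (auto simp: common_nbrs_def)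
    have "hd ys \<in> set ys" using that by (cases ys) (auto simp: ordered_simplices_def)
    then show "x \<in> V" using that by (auto simp: common_nbrs_def nbrs_def)
  qed
  moreover have "x \<in> nbrs V m y \<longleftrightarrow> y \<in> nbrs V m x" if "x \<in> V" "y \<in> V" for y
    using nbrs_sym that by blast
  ultimately show ?thesis
    unfolding ordered_simplices_def pairwise_def common_nbrs_def
    by (auto; blast)
qed

text \<open>
  Turns sums over \<open>(r + 1)\<close>-simplices into iterated sums, over \<open>r\<close>-simplices and their extensions.
\<close>
lemma bij_betw_Cons: "bij_betw (\<lambda>(ys, x). x # ys) (Sigma (F r) (common_nbrs V m)) (F (Suc r))"
proof (rule bij_betwI[where g = "\<lambda>xs. (tl xs, hd xs)"])
  show "(\<lambda>xs. (tl xs, hd xs)) \<in> F (Suc r) \<rightarrow> Sigma (F r) (common_nbrs V m)"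
  proof
    fix xs assume "xs \<in> F (Suc r)"
    then show "(tl xs, hd xs) \<in> Sigma (F r) (common_nbrs V m)"
      using Cons_in_simplices_iff[of "hd xs" "tl xs" r] length_simplex[of xs "Suc r"]
      by (cases xs) auto
  qed
  show "(\<lambda>(ys, x). x # ys) (tl xs, hd xs) = xs" if "xs \<in> F (Suc r)" for xs
    using length_simplex[OF that] by (cases xs) auto
qed (auto simp: Cons_in_simplices_iff)

lemma to_front_in: "xs \<in> F k \<Longrightarrow> i \<le> k \<Longrightarrow> to_front i xs \<in> F k"
  by (rule in_simplices_mset) (auto simp: mset_to_front length_simplex)

lemma omit_in: "xs \<in> F (Suc r) \<Longrightarrow> i \<le> Suc r \<Longrightarrow> omit i xs \<in> F r"
  using to_front_in[of xs "Suc r" i] by (simp add: to_front_def Cons_in_simplices_iff)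

lemma bij_betw_to_front: "i \<le> k \<Longrightarrow> bij_betw (to_front i) (F k) (F k)"
  by (rule bij_to_front) (auto simp: length_simplex intro: in_simplices_mset)

lemma weight_to_front: "xs \<in> F k \<Longrightarrow> k \<le> n \<Longrightarrow> i \<le> k \<Longrightarrow> m k (to_front i xs) = m k xs"
  by (rule weight_mset) (auto simp: mset_to_front length_simplex)

lemma oriented_in [simp]: "xs \<in> F k \<Longrightarrow> oriented xs \<in> oriented_simplices V m k"
  by (simp add: oriented_simplices_def)

lemma rep_in: "\<sigma> \<in> oriented_simplices V m k \<Longrightarrow> rep \<sigma> \<in> F k \<and> oriented (rep \<sigma>) = \<sigma>"
  by (auto simp: oriented_simplices_def oriented_rep_oriented mset_rep_oriented intro: in_simplices_mset)

lemma weight_rep: "xs \<in> F k \<Longrightarrow> k \<le> n \<Longrightarrow> m k (rep (oriented xs)) = m k xs"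
  by (rule weight_mset) (auto simp: mset_rep_oriented)

lemma cochains_iff:
  "f \<in> cochains V m k \<longleftrightarrow>
     (\<forall>\<sigma>. \<sigma> \<notin> oriented_simplices V m k \<longrightarrow> f \<sigma> = 0) \<and> alternating_on (F k) (\<lambda>xs. f (oriented xs))"
  unfolding cochains_def
  using simplices.alternating_permute[of k "\<lambda>xs. f (oriented xs)"]
    simplices.alternating_on_if_permute[of k "\<lambda>xs. f (oriented xs)"]
  by (auto simp: length_simplex)

definition cochain_of :: "nat \<Rightarrow> ('v list \<Rightarrow> complex) \<Rightarrow> 'v list set \<Rightarrow> complex" where
  "cochain_of k h \<sigma> = (if \<sigma> \<in> oriented_simplices V m k then h (rep \<sigma>) else 0)"

lemma cochain_of_oriented:
  "alternating_on (F k) h \<Longrightarrow> xs \<in> F k \<Longrightarrow> cochain_of k h (oriented xs) = h xs"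
  by (simp add: cochain_of_def simplices.alternating_rep)

lemma cochain_of_cochain: "alternating_on (F k) h \<Longrightarrow> cochain_of k h \<in> cochains V m k"
  unfolding cochains_iff
proof (intro conjI allI impI)
  assume h: "alternating_on (F k) h"
  show "alternating_on (F k) (\<lambda>xs. cochain_of k h (oriented xs))"
    unfolding alternating_on_def
  proof (intro allI impI)
    fix as x y bs assume xs: "as @ x # y # bs \<in> F k"
    moreover from xs have "as @ y # x # bs \<in> F k"
      by (rule in_simplices_mset) simp
    ultimately show "cochain_of k h (oriented (as @ y # x # bs))
        = - cochain_of k h (oriented (as @ x # y # bs))"
      using alternating_onD[OF h xs] by (simp add: cochain_of_oriented h)
  qed
qed (simp add: cochain_of_def)

section \<open>The weighted coboundary and its adjoint\<close>

text \<open>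
  Swapping the vertices at positions \<open>j\<close> and \<open>j + 1\<close> exchanges the faces opposite to them, whose
  signs \<open>(-1)\<^sup>j\<close> and \<open>(-1)\<^sup>j\<^sup>+\<^sup>1\<close> differ; in every other face it swaps two adjacent vertices.
\<close>
lemma alternating_coboundary:
  assumes G: "alternating_on (F r) G"
  shows "alternating_on (F (Suc r)) (\<lambda>xs. \<Sum>i\<le>Suc r. (-1) ^ i * G (omit i xs))"
  unfolding alternating_on_def
proof (intro allI impI)
  fix as bs :: "'v list" and x y
  let ?xs = "as @ x # y # bs" and ?ys = "as @ y # x # bs" and ?j = "length as"
  let ?t = "Transposition.transpose ?j (Suc ?j)"
  assume xs: "?xs \<in> F (Suc r)"
  then have j: "?j \<le> r" using length_simplex[OF xs] by simp
  have t: "?t permutes {..Suc r}"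
    using j by (intro permutes_swap_id) auto
  have "(-1) ^ ?t i * G (omit (?t i) ?ys) = - ((-1) ^ i * G (omit i ?xs))" if i: "i \<le> Suc r" for i
  proof -
    consider "i = ?j" | "i = Suc ?j" | "i < ?j" | "i > Suc ?j" by linarith
    then show ?thesis
    proof cases
      case 3
      then have "omit i ?xs = omit i as @ x # y # bs" "omit i ?ys = omit i as @ y # x # bs"
        by simp_all
      with 3 show ?thesis
        using alternating_onD[OF G, of "omit i as" x y bs] omit_in[OF xs i] by simp
    next
      case 4
      then obtain l where l: "i = Suc (Suc (?j + l))"
        using less_imp_Suc_add[of "Suc ?j" i] by auto
      then have "omit i ?xs = as @ x # y # omit l bs" "omit i ?ys = as @ y # x # omit l bs"
        by (simp_all add: numeral_3_eq_3)
      with l show ?thesis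
        using alternating_onD[OF G, of as x y "omit l bs"] omit_in[OF xs i] by simp
    qed simp_all
  qed
  then have "(\<Sum>i\<le>Suc r. (-1) ^ ?t i * G (omit (?t i) ?ys)) = - (\<Sum>i\<le>Suc r. (-1) ^ i * G (omit i ?xs))"
    unfolding sum_negf[symmetric] by (intro sum.cong) auto
  moreover have "(\<Sum>i\<le>Suc r. (-1) ^ i * G (omit i ?ys)) = (\<Sum>i\<le>Suc r. (-1) ^ ?t i * G (omit (?t i) ?ys))"
    using sum.permute[OF t, of "\<lambda>i. (-1) ^ i * G (omit i ?ys)"] by (simp only: o_def)
  ultimately show "(\<Sum>i\<le>Suc r. (-1) ^ i * G (omit i ?ys)) = - (\<Sum>i\<le>Suc r. (-1) ^ i * G (omit i ?xs))"
    by (rule trans[rotated])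
qed

lemma alternating_times_weight:
  assumes G: "alternating_on (F k) G" and k: "k \<le> n"
  shows "alternating_on (F k) (\<lambda>xs. w (m k xs) * G xs)"
  unfolding alternating_on_def
proof (intro allI impI)
  fix as x y bs assume xs: "as @ x # y # bs \<in> F k"
  have "m k (as @ y # x # bs) = m k (as @ x # y # bs)"
    by (rule weight_mset[OF xs k]) simp
  then show "w (m k (as @ y # x # bs)) * G (as @ y # x # bs)
      = - (w (m k (as @ x # y # bs)) * G (as @ x # y # bs))"
    using alternating_onD[OF G xs] by simp
qed

definition wcoboundary :: "nat \<Rightarrow> ('v list set \<Rightarrow> complex) \<Rightarrow> 'v list set \<Rightarrow> complex" where
  "wcoboundary r f = mult_weight m (Suc r) (1/2) (coboundary V n m (Suc r) (mult_weight m r (-1/2) f))"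

definition wdelta :: "nat \<Rightarrow> ('v list set \<Rightarrow> complex) \<Rightarrow> 'v list set \<Rightarrow> complex" where
  "wdelta r g = mult_weight m r (1/2) (delta V m (Suc r) (mult_weight m (Suc r) (-1/2) g))"

text \<open>
  The contribution to \<open>wcoboundary r f\<close> of the face opposite to the first vertex. The other faces are
  covered by moving their opposite vertex to the front. The root combines \<open>M\<^sup>1\<^sup>/\<^sup>2\<close> in degree \<open>r + 1\<close> with
  \<open>M\<^sup>-\<^sup>1\<^sup>/\<^sup>2\<close> in degree \<open>r\<close>.
\<close>
definition face_term :: "nat \<Rightarrow> ('v list set \<Rightarrow> complex) \<Rightarrow> 'v list \<Rightarrow> complex" where
  "face_term r f xs = of_real (sqrt (m (Suc r) xs / m r (tl xs))) * f (oriented (tl xs))"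

definition wcoboundary_sum :: "nat \<Rightarrow> ('v list set \<Rightarrow> complex) \<Rightarrow> 'v list \<Rightarrow> complex" where
  "wcoboundary_sum r f xs = (\<Sum>i\<le>Suc r. (-1) ^ i * face_term r f (to_front i xs))"

definition wdelta_sum :: "nat \<Rightarrow> ('v list set \<Rightarrow> complex) \<Rightarrow> 'v list \<Rightarrow> complex" where
  "wdelta_sum r g ys =
     (\<Sum>\<^sub>\<infinity>x\<in>common_nbrs V m ys. of_real (sqrt (m (Suc r) (x # ys) / m r ys)) * g (oriented (x # ys)))"

lemma face_term_to_front:
  assumes "r < n" "xs \<in> F (Suc r)" "i \<le> Suc r"
  shows "face_term r f (to_front i xs) = of_real (sqrt (m (Suc r) xs)) *
    (of_real (1 / sqrt (m r (omit i xs))) * f (oriented (omit i xs)))"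
  using assms by (simp add: face_term_def weight_to_front real_sqrt_divide)

lemma wcoboundary_sum_eq:
  assumes "r < n" "xs \<in> F (Suc r)"
  shows "wcoboundary_sum r f xs = of_real (sqrt (m (Suc r) xs)) *
    (\<Sum>i\<le>Suc r. (-1) ^ i * (of_real (1 / sqrt (m r (omit i xs))) * f (oriented (omit i xs))))"
  unfolding wcoboundary_sum_def sum_distrib_left
proof (rule sum.cong)
  fix i assume "i \<in> {..Suc r}"
  then show "(-1) ^ i * face_term r f (to_front i xs) = of_real (sqrt (m (Suc r) xs)) *
      ((-1) ^ i * (of_real (1 / sqrt (m r (omit i xs))) * f (oriented (omit i xs))))"
    using face_term_to_front[OF assms, of i f] by (simp del: tl_to_front)
qed simp

lemma alternating_cong:
  assumes "\<And>xs. xs \<in> F k \<Longrightarrow> G xs = H xs" "alternating_on (F k) G"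
  shows "alternating_on (F k) H"
  unfolding alternating_on_def
proof (intro allI impI)
  fix as x y bs assume xs: "as @ x # y # bs \<in> F k"
  moreover have "as @ y # x # bs \<in> F k"
    by (rule in_simplices_mset[OF xs]) simp
  ultimately show "H (as @ y # x # bs) = - H (as @ x # y # bs)"
    using assms(1)[symmetric] alternating_onD[OF assms(2) xs] by simp
qed

lemma alternating_wd_sum:
  assumes "r < n" "f \<in> cochains V m r"
  shows "alternating_on (F (Suc r)) (wcoboundary_sum r f)"
proof (rule alternating_cong)
  have "alternating_on (F r) (\<lambda>ys. f (oriented ys))"
    using assms by (simp add: cochains_iff)
  then have "alternating_on (F r) (\<lambda>ys. of_real (1 / sqrt (m r ys)) * f (oriented ys))"
    using assms alternating_times_weight[of r _ "\<lambda>w. of_real (1 / sqrt w)"] by simp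
  from alternating_times_weight[OF alternating_coboundary[OF this], of "\<lambda>w. of_real (sqrt w)"]
  show "alternating_on (F (Suc r)) (\<lambda>xs. of_real (sqrt (m (Suc r) xs)) *
    (\<Sum>i\<le>Suc r. (-1) ^ i * (of_real (1 / sqrt (m r (omit i xs))) * f (oriented (omit i xs)))))"
    using assms by (simp only: Suc_le_eq)
qed (rule wcoboundary_sum_eq[OF assms(1), symmetric])

lemma alternating_wdelta_sum:
  assumes "r < n" "g \<in> cochains V m (Suc r)"
  shows "alternating_on (F r) (wdelta_sum r g)"
  unfolding alternating_on_def
proof (intro allI impI)
  fix as bs :: "'v list" and x y
  let ?xs = "as @ x # y # bs" and ?ys = "as @ y # x # bs"
  assume xs: "?xs \<in> F r"
  have g: "alternating_on (F (Suc r)) (\<lambda>xs. g (oriented xs))"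
    using assms by (simp add: cochains_iff)
  have "of_real (sqrt (m (Suc r) (z # ?ys) / m r ?ys)) * g (oriented (z # ?ys))
      = - (of_real (sqrt (m (Suc r) (z # ?xs) / m r ?xs)) * g (oriented (z # ?xs)))"
    if "z \<in> common_nbrs V m ?xs" for z
  proof -
    have z: "z # ?xs \<in> F (Suc r)" using that xs by (simp add: Cons_in_simplices_iff)
    have "m (Suc r) (z # ?ys) = m (Suc r) (z # ?xs)"
      by (rule weight_mset[OF z]) (use assms in auto)
    moreover have "m r ?ys = m r ?xs"
      by (rule weight_mset[OF xs]) (use assms in auto)
    ultimately show ?thesis
      using alternating_onD[OF g, of "z # as" x y bs] z by simp
  qed
  moreover have "common_nbrs V m ?ys = common_nbrs V m ?xs"
    by (simp add: common_nbrs_def insert_commute)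
  ultimately show "wdelta_sum r g ?ys = - wdelta_sum r g ?xs"
    unfolding wdelta_sum_def infsum_uminus[symmetric] by (auto intro!: infsum_cong)
qed

lemma mult_weight_half_cancel:
  assumes "k \<le> n" "\<And>\<sigma>. \<sigma> \<notin> oriented_simplices V m k \<Longrightarrow> h \<sigma> = 0"
  shows "mult_weight m k (-1/2) (mult_weight m k (1/2) h) = h"
proof
  fix \<sigma>
  show "mult_weight m k (-1/2) (mult_weight m k (1/2) h) \<sigma> = h \<sigma>"
  proof (cases "\<sigma> \<in> oriented_simplices V m k")
    case True
    then have "0 < m k (rep \<sigma>)"
      using rep_in assms(1) weight_positive by blast
    then show ?thesis
      unfolding mult_weight_def
      by (simp flip: of_real_mult mult.assoc powr_add)
  qed (simp add: mult_weight_def assms)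
qed

lemma wcoboundary_eq: assumes r: "r < n" shows "wcoboundary r f = cochain_of (Suc r) (wcoboundary_sum r f)"
proof
  fix \<sigma>
  show "wcoboundary r f \<sigma> = cochain_of (Suc r) (wcoboundary_sum r f) \<sigma>"
  proof (cases "\<sigma> \<in> oriented_simplices V m (Suc r)")
    case True
    then have xs: "rep \<sigma> \<in> F (Suc r)" using rep_in by blast
    have "mult_weight m r (-1/2) f (oriented (omit i (rep \<sigma>)))
        = of_real (1 / sqrt (m r (omit i (rep \<sigma>)))) * f (oriented (omit i (rep \<sigma>)))"
      if "i \<le> Suc r" for i
      using omit_in[OF xs that] r weight_rep[of "omit i (rep \<sigma>)" r] weight_positive[of "omit i (rep \<sigma>)" r]
      by (simp add: mult_weight_def powr_half_sqrt powr_minus_half)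
    then have "coboundary V n m (Suc r) (mult_weight m r (-1/2) f) \<sigma> =
       (\<Sum>i\<le>Suc r. (-1) ^ i * (of_real (1 / sqrt (m r (omit i (rep \<sigma>)))) * f (oriented (omit i (rep \<sigma>)))))"
      unfolding coboundary_def using True r by (auto intro!: sum.cong simp del: sum.atMost_Suc)
    moreover have "m (Suc r) (rep \<sigma>) powr (1/2) = sqrt (m (Suc r) (rep \<sigma>))"
      using weight_positive[OF xs] r by (simp add: powr_half_sqrt powr_minus_half)
    ultimately show ?thesis
      using True unfolding wcoboundary_def mult_weight_def[of m "Suc r"] cochain_of_def
      by (simp only: wcoboundary_sum_eq[OF r xs] if_True)
  qed (simp add: wcoboundary_def mult_weight_def coboundary_def cochain_of_def)
qed

lemma wdelta_eq: assumes r: "r < n" shows "wdelta r g = cochain_of r (wdelta_sum r g)"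
proof
  fix \<sigma>
  show "wdelta r g \<sigma> = cochain_of r (wdelta_sum r g) \<sigma>"
  proof (cases "\<sigma> \<in> oriented_simplices V m r")
    case True
    define ys where "ys = rep \<sigma>"
    have ys: "ys \<in> F r" using True rep_in by (simp add: ys_def)
    then have pos: "0 < m r ys" using weight_positive r by simp
    have "of_real (m r ys powr (1/2)) * (1 / of_real (m r ys)) *
        (of_real (m (Suc r) (x # ys)) * mult_weight m (Suc r) (-1/2) g (oriented (x # ys)))
        = of_real (sqrt (m (Suc r) (x # ys) / m r ys)) * g (oriented (x # ys))"
      if "x \<in> common_nbrs V m ys" for x
    proof -
      have x: "x # ys \<in> F (Suc r)" using that ys by (simp add: Cons_in_simplices_iff)
      then have pos': "0 < m (Suc r) (x # ys)" using weight_positive r by simp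
      have "m r ys powr (1/2) * (1 / m r ys) * (m (Suc r) (x # ys) * (m (Suc r) (x # ys) powr (-1/2)))
          = sqrt (m (Suc r) (x # ys) / m r ys)"
      proof -
        have "sqrt (m r ys) * (1 / m r ys) = 1 / sqrt (m r ys)"
          using pos real_div_sqrt[of "m r ys"] by (simp add: field_simps)
        moreover have "m (Suc r) (x # ys) * (1 / sqrt (m (Suc r) (x # ys))) = sqrt (m (Suc r) (x # ys))"
          using pos' real_div_sqrt[of "m (Suc r) (x # ys)"] by simp
        ultimately show ?thesis
          using pos pos' by (simp add: powr_half_sqrt powr_minus_half real_sqrt_divide)
      qed
      then show ?thesis
        unfolding mult_weight_def using weight_rep[OF x] r
        by (simp flip: of_real_mult of_real_divide mult.assoc)
    qed
    moreover have "wdelta r g \<sigma> = of_real (m r ys powr (1/2)) * (1 / of_real (m r ys)) *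
        (\<Sum>\<^sub>\<infinity>x\<in>common_nbrs V m ys.
          of_real (m (Suc r) (x # ys)) * mult_weight m (Suc r) (-1/2) g (oriented (x # ys)))"
      using True unfolding wdelta_def mult_weight_def[of m r] delta_def ys_def by simp
    ultimately show ?thesis
      using True unfolding cochain_of_def wdelta_sum_def ys_def[symmetric]
      by (auto simp flip: infsum_cmult_right' intro!: infsum_cong)
  qed (simp add: wdelta_def mult_weight_def delta_def cochain_of_def)
qed

lemma wcoboundary_cochain: "r < n \<Longrightarrow> f \<in> cochains V m r \<Longrightarrow> wcoboundary r f \<in> cochains V m (Suc r)"
  by (simp add: wcoboundary_eq cochain_of_cochain alternating_wd_sum)

lemma wcoboundary_oriented:
  "r < n \<Longrightarrow> f \<in> cochains V m r \<Longrightarrow> xs \<in> F (Suc r) \<Longrightarrow> wcoboundary r f (oriented xs) = wcoboundary_sum r f xs"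
  by (simp add: wcoboundary_eq cochain_of_oriented alternating_wd_sum)

lemma wdelta_cochain: "r < n \<Longrightarrow> g \<in> cochains V m (Suc r) \<Longrightarrow> wdelta r g \<in> cochains V m r"
  by (simp add: wdelta_eq cochain_of_cochain alternating_wdelta_sum)

lemma wdelta_oriented:
  "r < n \<Longrightarrow> g \<in> cochains V m (Suc r) \<Longrightarrow> ys \<in> F r \<Longrightarrow> wdelta r g (oriented ys) = wdelta_sum r g ys"
  by (simp add: wdelta_eq cochain_of_oriented alternating_wdelta_sum)

text \<open>
  In the two compositions below, the weights \<open>M\<^sup>1\<^sup>/\<^sup>2\<close> and \<open>M\<^sup>-\<^sup>1\<^sup>/\<^sup>2\<close> in the intermediate degree cancel.
\<close>
lemma LL_down_Suc: assumes "r < n" shows "LL_down V n m (Suc r) u = wcoboundary r (wdelta r u)"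
  unfolding LL_down_def L_down_def wcoboundary_def wdelta_def
  using assms by (subst mult_weight_half_cancel) (auto simp: delta_def)

lemma LL_down_0: "LL_down V n m 0 u = (\<lambda>\<sigma>. 0)"
  unfolding LL_down_def L_down_def by (auto simp: delta_def coboundary_def mult_weight_def)

lemma LL_up_eq: assumes "r < n" shows "LL_up V n m r u = wdelta r (wcoboundary r u)"
  unfolding LL_up_def L_up_def wcoboundary_def wdelta_def Suc_eq_plus1[symmetric]
  using assms by (subst mult_weight_half_cancel) (auto simp: coboundary_def)

lemma LL_up_top: "LL_up V n m n u = (\<lambda>\<sigma>. 0)"
  unfolding LL_up_def L_up_def by (auto simp: delta_def coboundary_def mult_weight_def)

section \<open>Adjointness and the norm bounds\<close>

lemma summable_on_Cons_iff:
  "\<phi> summable_on F (Suc r) \<longleftrightarrow> (\<lambda>(ys, x). \<phi> (x # ys)) summable_on Sigma (F r) (common_nbrs V m)"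
  using summable_on_reindex_bij_betw[OF bij_betw_Cons, of \<phi>] by (simp add: case_prod_unfold)

lemma
  fixes \<phi> :: "'v list \<Rightarrow> 'c::banach"
  assumes "\<phi> summable_on F (Suc r)"
  shows infsum_Cons: "infsum \<phi> (F (Suc r)) = (\<Sum>\<^sub>\<infinity>ys\<in>F r. \<Sum>\<^sub>\<infinity>x\<in>common_nbrs V m ys. \<phi> (x # ys))"
    and summable_Cons_outer: "(\<lambda>ys. \<Sum>\<^sub>\<infinity>x\<in>common_nbrs V m ys. \<phi> (x # ys)) summable_on F r"
    and summable_Cons_inner: "ys \<in> F r \<Longrightarrow> (\<lambda>x. \<phi> (x # ys)) summable_on common_nbrs V m ys"
proof -
  have S: "(\<lambda>(ys, x). \<phi> (x # ys)) summable_on Sigma (F r) (common_nbrs V m)"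
    using assms by (simp add: summable_on_Cons_iff)
  have "infsum \<phi> (F (Suc r)) = (\<Sum>\<^sub>\<infinity>(ys, x)\<in>Sigma (F r) (common_nbrs V m). \<phi> (x # ys))"
    using infsum_reindex_bij_betw[OF bij_betw_Cons, of \<phi>] by (simp add: case_prod_unfold)
  with infsum_Sigma'_banach[OF S]
  show "infsum \<phi> (F (Suc r)) = (\<Sum>\<^sub>\<infinity>ys\<in>F r. \<Sum>\<^sub>\<infinity>x\<in>common_nbrs V m ys. \<phi> (x # ys))"
    by simp
  show "(\<lambda>ys. \<Sum>\<^sub>\<infinity>x\<in>common_nbrs V m ys. \<phi> (x # ys)) summable_on F r"
    using summable_on_Sigma_banach[OF S] by simp
  show "(\<lambda>x. \<phi> (x # ys)) summable_on common_nbrs V m ys" if ys: "ys \<in> F r"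
  proof -
    have "(\<lambda>(ys, x). \<phi> (x # ys)) summable_on Pair ys ` common_nbrs V m ys"
      by (rule summable_on_subset_banach[OF S]) (use ys in auto)
    then show ?thesis
      by (subst (asm) summable_on_reindex) (auto simp: inj_on_def o_def)
  qed
qed

definition upper_weight :: "nat \<Rightarrow> 'v list \<Rightarrow> real" where
  "upper_weight r ys = (\<Sum>\<^sub>\<infinity>x\<in>common_nbrs V m ys. m (Suc r) (x # ys))"

lemma weight_snoc:
  assumes "r < n" "ys \<in> F r" "x \<in> common_nbrs V m ys"
  shows "m (Suc r) (ys @ [x]) = m (Suc r) (x # ys)"
  by (rule weight_mset) (use assms in \<open>auto simp: Cons_in_simplices_iff\<close>)

lemma weight_Cons_pos:
  "r < n \<Longrightarrow> ys \<in> F r \<Longrightarrow> x \<in> common_nbrs V m ys \<Longrightarrow> 0 < m (Suc r) (x # ys)"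
  using weight_positive[of "x # ys" "Suc r"] by (simp add: Cons_in_simplices_iff)

lemma weight_Cons_summable:
  assumes "r < n" "ys \<in> F r"
  shows "(\<lambda>x. m (Suc r) (x # ys)) summable_on common_nbrs V m ys"
  using weight_summable[OF assms] weight_snoc[OF assms]
  by (subst summable_on_cong[where g = "\<lambda>x. m (Suc r) (ys @ [x])"]) auto

lemma weight_Cons_has_sum:
  "r < n \<Longrightarrow> ys \<in> F r \<Longrightarrow> ((\<lambda>x. m (Suc r) (x # ys)) has_sum upper_weight r ys) (common_nbrs V m ys)"
  using weight_Cons_summable unfolding upper_weight_def by (rule has_sum_infsum)

lemma upper_weight_nonneg: "r < n \<Longrightarrow> ys \<in> F r \<Longrightarrow> 0 \<le> upper_weight r ys"
  unfolding upper_weight_def using weight_Cons_pos by (intro infsum_nonneg) (auto intro: less_imp_le)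

text \<open>
  The hypothesis of the estimates below: \<open>D\<close> is a real upper bound for the upper degree in degree \<open>r\<close>,
  which is also the lower degree in degree \<open>r + 1\<close>. The form without division is the one that is summed.
\<close>
definition upper_degree_le :: "nat \<Rightarrow> real \<Rightarrow> bool" where
  "upper_degree_le r D \<longleftrightarrow> 0 \<le> D \<and> (\<forall>ys\<in>F r. real (r + 2) * upper_weight r ys \<le> D * m r ys)"

lemma deg_down_Suc:
  assumes "r < n"
  shows "deg_down V m (Suc r) = deg_up V n m r"
  using assms by (simp add: deg_down_def deg_up_def)

lemma upper_degree_le_deg_up:
  assumes r: "r < n" and fin: "deg_up V n m r < \<infinity>"
  shows "upper_degree_le r (enn2real (deg_up V n m r))"
  unfolding upper_degree_le_def
proof (intro conjI ballI)
  fix ys assume ys: "ys \<in> F r"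
  have pos: "0 < m r ys" using ys r weight_positive by simp
  have "(\<Sum>\<^sub>\<infinity>x\<in>common_nbrs V m ys. ennreal (m (r + 1) (ys @ [x])))
      = (\<Sum>\<^sub>\<infinity>x\<in>common_nbrs V m ys. ennreal (m (Suc r) (x # ys)))"
    using weight_snoc[OF r ys] by (intro infsum_cong) simp
  also have "\<dots> = ennreal (upper_weight r ys)"
    unfolding upper_weight_def using weight_Cons_pos[OF r ys]
    by (intro infsum_ennreal_eq weight_Cons_summable r ys) (auto intro: less_imp_le)
  finally have "of_nat (r + 2) * (ennreal (upper_weight r ys) / ennreal (m r ys)) \<le> deg_up V n m r"
    unfolding deg_up_def using r ys
    by (auto intro!: mult_left_mono SUP_upper2[OF ys])
  also have "of_nat (r + 2) * (ennreal (upper_weight r ys) / ennreal (m r ys))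
      = ennreal (real (r + 2) * (upper_weight r ys / m r ys))"
    using pos upper_weight_nonneg[OF r ys]
    by (subst divide_ennreal, simp_all only: ennreal_mult ennreal_of_nat_eq_real_of_nat of_nat_0_le_iff
        divide_nonneg_pos)
  also have "deg_up V n m r = ennreal (enn2real (deg_up V n m r))"
    using fin by simp
  finally have "real (r + 2) * (upper_weight r ys / m r ys) \<le> enn2real (deg_up V n m r)"
    by (simp only: ennreal_le_iff enn2real_nonneg)
  then show "real (r + 2) * upper_weight r ys \<le> enn2real (deg_up V n m r) * m r ys"
    using pos by (simp add: field_simps)
qed simp

lemma face_term_Cons:
  assumes "r < n" "ys \<in> F r" "x \<in> common_nbrs V m ys"
  shows "(cmod (face_term r f (x # ys)))\<^sup>2 = m (Suc r) (x # ys) * ((cmod (f (oriented ys)))\<^sup>2 / m r ys)"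
  using weight_positive[of ys r] weight_Cons_pos[OF assms] assms
  by (simp add: face_term_def norm_mult power_mult_distrib)

text \<open>
  The squares of the face terms over one face \<open>ys\<close> add up to a multiple of \<open>\<bar>f ys\<bar>\<^sup>2\<close>. All
  control of \<open>wcoboundary r f\<close> comes from this.
\<close>
lemma face_term_has_sum:
  assumes "r < n" "ys \<in> F r"
  shows "((\<lambda>x. (cmod (face_term r f (x # ys)))\<^sup>2) has_sum
    (upper_weight r ys * ((cmod (f (oriented ys)))\<^sup>2 / m r ys))) (common_nbrs V m ys)"
  using has_sum_cmult_left[OF weight_Cons_has_sum[OF assms], of "(cmod (f (oriented ys)))\<^sup>2 / m r ys"]
  by (subst has_sum_cong[OF face_term_Cons[OF assms]]) auto

lemma face_term_square_summable:
  assumes r: "r < n"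
    and S: "(\<lambda>ys. upper_weight r ys * ((cmod (f (oriented ys)))\<^sup>2 / m r ys)) summable_on F r"
  shows "face_term r f square_summable_on F (Suc r)"
  unfolding square_summable_on_def summable_on_Cons_iff
  by (rule summable_on_SigmaI[OF _ S]) (use face_term_has_sum[OF r] in auto)

lemma face_term_infsum:
  assumes r: "r < n" and f: "face_term r f square_summable_on F (Suc r)"
  shows "(\<Sum>\<^sub>\<infinity>xs\<in>F (Suc r). (cmod (face_term r f xs))\<^sup>2)
    = (\<Sum>\<^sub>\<infinity>ys\<in>F r. upper_weight r ys * ((cmod (f (oriented ys)))\<^sup>2 / m r ys))"
  unfolding infsum_Cons[OF f[unfolded square_summable_on_def]]
  by (intro infsum_cong infsumI face_term_has_sum[OF r])

lemma face_term_to_front_square_summable: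
  assumes "face_term r f square_summable_on F (Suc r)" "i \<le> Suc r"
  shows "(\<lambda>xs. face_term r f (to_front i xs)) square_summable_on F (Suc r)"
  using assms summable_on_reindex_bij_betw[OF bij_betw_to_front[OF assms(2)],
      of "\<lambda>xs. (cmod (face_term r f xs))\<^sup>2"]
  unfolding square_summable_on_def by simp

abbreviation square_sum :: "nat \<Rightarrow> ('v list set \<Rightarrow> complex) \<Rightarrow> real" where
  "square_sum k f \<equiv> \<Sum>\<^sub>\<infinity>xs\<in>F k. (cmod (f (oriented xs)))\<^sup>2"

lemma l2_space_iff:
  "f \<in> l2_space V m k \<longleftrightarrow> f \<in> cochains V m k \<and> (\<lambda>xs. f (oriented xs)) square_summable_on F k"
  by (simp add: l2_space_def square_summable_on_def)

lemma wcoboundary_l2: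
  assumes r: "r < n" and f: "f \<in> cochains V m r" "face_term r f square_summable_on F (Suc r)"
  shows "wcoboundary r f \<in> l2_space V m (Suc r)"
proof -
  have "wcoboundary_sum r f square_summable_on F (Suc r)"
    unfolding wcoboundary_sum_def
    by (intro square_summable_sum square_summable_scale face_term_to_front_square_summable f) auto
  then show ?thesis
    using r f wcoboundary_oriented[OF r f(1)]
    unfolding l2_space_iff square_summable_on_def
    by (auto simp: wcoboundary_cochain cong: summable_on_cong)
qed

text \<open>
  The products of the face terms with \<open>g\<close> are absolutely summable by Cauchy-Schwarz, and this
  justifies each exchange of sums. The hypothesis on \<open>f\<close> is the domain condition for the
  coboundary; it covers finitely supported \<open>f\<close> when the degree is infinite. All \<open>r + 2\<close> faces give
  the same sum, and the factor \<open>r + 2\<close> turns the normalisation \<open>1 / (r + 2)!\<close> of the inner product in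
  degree \<open>r + 1\<close> into the one in degree \<open>r\<close>.
\<close>
lemma adjoint:
  assumes r: "r < n" and f: "f \<in> cochains V m r" "face_term r f square_summable_on F (Suc r)"
    and g: "g \<in> l2_space V m (Suc r)"
  shows "l2_inner V m (Suc r) (wcoboundary r f) g = l2_inner V m r f (wdelta r g)"
proof -
  have gc: "g \<in> cochains V m (Suc r)" and gs: "(\<lambda>xs. cnj (g (oriented xs))) square_summable_on F (Suc r)"
    using g by (simp_all add: l2_space_iff square_summable_on_def)
  have galt: "alternating_on (F (Suc r)) (\<lambda>xs. g (oriented xs))"
    using gc by (simp add: cochains_iff)
  let ?h = "\<lambda>xs. face_term r f xs * cnj (g (oriented xs))"
  have h: "?h summable_on F (Suc r)"
    by (rule Infinite_Sum.abs_summable_summable) (rule square_summable_mult[OF f(2) gs])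
  \<comment> \<open>The sign of the \<open>i\<close>-th face is absorbed by \<open>g\<close>, which is alternating.\<close>
  have front: "(-1) ^ i * face_term r f (to_front i xs) * cnj (g (oriented xs)) = ?h (to_front i xs)"
    if "i \<le> Suc r" "xs \<in> F (Suc r)" for i xs
    using simplices.alternating_to_front[OF galt that(2), of i] that length_simplex[OF that(2)]
    by simp
  have "(\<Sum>\<^sub>\<infinity>xs\<in>F (Suc r). wcoboundary r f (oriented xs) * cnj (g (oriented xs)))
      = (\<Sum>\<^sub>\<infinity>xs\<in>F (Suc r). \<Sum>i\<le>Suc r. ?h (to_front i xs))"
  proof (rule infsum_cong)
    fix xs assume xs: "xs \<in> F (Suc r)"
    show "wcoboundary r f (oriented xs) * cnj (g (oriented xs)) = (\<Sum>i\<le>Suc r. ?h (to_front i xs))"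
      unfolding wcoboundary_oriented[OF r f(1) xs] wcoboundary_sum_def sum_distrib_right
      by (intro sum.cong refl front xs) simp
  qed
  also have "\<dots> = (\<Sum>i\<le>Suc r. \<Sum>\<^sub>\<infinity>xs\<in>F (Suc r). ?h (to_front i xs))"
  proof (rule infsum_finite_sum)
    fix i assume "i \<in> {..Suc r}"
    then show "(\<lambda>xs. ?h (to_front i xs)) summable_on F (Suc r)"
      using summable_on_reindex_bij_betw[OF bij_betw_to_front[of i "Suc r"], of ?h] h by simp
  qed simp
  also have "\<dots> = (\<Sum>i\<le>Suc r. infsum ?h (F (Suc r)))"
    using infsum_reindex_bij_betw[OF bij_betw_to_front, where f = ?h]
    by (intro sum.cong refl) auto
  also have "\<dots> = of_nat (r + 2) * infsum ?h (F (Suc r))"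
    by (simp del: sum.atMost_Suc)
  also have "infsum ?h (F (Suc r)) = (\<Sum>\<^sub>\<infinity>ys\<in>F r. \<Sum>\<^sub>\<infinity>x\<in>common_nbrs V m ys. ?h (x # ys))"
    using h by (rule infsum_Cons)
  also have "\<dots> = (\<Sum>\<^sub>\<infinity>ys\<in>F r. f (oriented ys) * cnj (wdelta r g (oriented ys)))"
  proof (rule infsum_cong)
    fix ys assume ys: "ys \<in> F r"
    have "(\<Sum>\<^sub>\<infinity>x\<in>common_nbrs V m ys. ?h (x # ys)) = (\<Sum>\<^sub>\<infinity>x\<in>common_nbrs V m ys.
        f (oriented ys) * cnj (of_real (sqrt (m (Suc r) (x # ys) / m r ys)) * g (oriented (x # ys))))"
      by (simp add: face_term_def mult_ac)
    also have "\<dots> = f (oriented ys) * cnj (wdelta_sum r g ys)"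
      unfolding wdelta_sum_def infsum_cmult_right' infsum_cnj ..
    finally show "(\<Sum>\<^sub>\<infinity>x\<in>common_nbrs V m ys. ?h (x # ys)) = f (oriented ys) * cnj (wdelta r g (oriented ys))"
      by (simp add: wdelta_oriented[OF r gc ys])
  qed
  finally have sum_eq: "(\<Sum>\<^sub>\<infinity>xs\<in>F (Suc r). wcoboundary r f (oriented xs) * cnj (g (oriented xs)))
    = of_nat (r + 2) * (\<Sum>\<^sub>\<infinity>ys\<in>F r. f (oriented ys) * cnj (wdelta r g (oriented ys)))" .
  have "(fact (Suc r + 1) :: complex) = of_nat (r + 2) * fact (r + 1)" "(of_nat (r + 2) :: complex) \<noteq> 0"
    by (simp add: fact_Suc, simp only: of_nat_eq_0_iff)
  then have "1 / fact (Suc r + 1) * (of_nat (r + 2) * z) = 1 / fact (r + 1) * z" for z :: complex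
    by (simp del: fact_Suc of_nat_add)
  then show ?thesis
    unfolding l2_inner_def sum_eq .
qed

lemma wdelta_term_square_summable:
  assumes r: "r < n" and g: "g \<in> l2_space V m (Suc r)" and ys: "ys \<in> F r"
  shows "(\<lambda>x. g (oriented (x # ys))) square_summable_on common_nbrs V m ys"
    and "(\<lambda>x. of_real (sqrt (m (Suc r) (x # ys) / m r ys))) square_summable_on common_nbrs V m ys"
    and "(\<Sum>\<^sub>\<infinity>x\<in>common_nbrs V m ys. (cmod (of_real (sqrt (m (Suc r) (x # ys) / m r ys))))\<^sup>2)
      = upper_weight r ys / m r ys"
proof -
  show "(\<lambda>x. g (oriented (x # ys))) square_summable_on common_nbrs V m ys"
    using g summable_Cons_inner[OF _ ys] by (auto simp: l2_space_iff square_summable_on_def)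
  have "(cmod (of_real (sqrt (m (Suc r) (x # ys) / m r ys))))\<^sup>2 = m (Suc r) (x # ys) * (1 / m r ys)"
    if "x \<in> common_nbrs V m ys" for x
    using weight_Cons_pos[OF r ys that] weight_positive[OF ys] r by simp
  then have "((\<lambda>x. (cmod (of_real (sqrt (m (Suc r) (x # ys) / m r ys))))\<^sup>2) has_sum
      upper_weight r ys * (1 / m r ys)) (common_nbrs V m ys)"
    using has_sum_cmult_left[OF weight_Cons_has_sum[OF r ys], of "1 / m r ys"]
    by (subst has_sum_cong)
  then show "(\<lambda>x. of_real (sqrt (m (Suc r) (x # ys) / m r ys))) square_summable_on common_nbrs V m ys"
    and "(\<Sum>\<^sub>\<infinity>x\<in>common_nbrs V m ys. (cmod (of_real (sqrt (m (Suc r) (x # ys) / m r ys))))\<^sup>2)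
      = upper_weight r ys / m r ys"
    unfolding square_summable_on_def has_sum_iff by simp_all
qed

text \<open>
  Both factors are square summable: the weights because the extensions of \<open>ys\<close> have finite total
  weight, and the values of \<open>g\<close> as part of the sum of squares over all simplices.
\<close>
lemma wdelta_sum_summable:
  assumes "r < n" "g \<in> l2_space V m (Suc r)" "ys \<in> F r"
  shows "(\<lambda>x. of_real (sqrt (m (Suc r) (x # ys) / m r ys)) * g (oriented (x # ys)))
    summable_on common_nbrs V m ys"
  by (rule Infinite_Sum.abs_summable_summable)
    (rule square_summable_mult[OF wdelta_term_square_summable(2,1)[OF assms]])

text \<open>
  Cauchy-Schwarz over the extensions of \<open>ys\<close>, with the square roots of the weights as one factor.
\<close>
lemma wdelta_sum_bound:
  assumes r: "r < n" and g: "g \<in> l2_space V m (Suc r)" and ys: "ys \<in> F r"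
  shows "(cmod (wdelta_sum r g ys))\<^sup>2 \<le>
    upper_weight r ys / m r ys * (\<Sum>\<^sub>\<infinity>x\<in>common_nbrs V m ys. (cmod (g (oriented (x # ys))))\<^sup>2)"
    (is "_ \<le> ?a * ?b")
proof -
  note t = wdelta_term_square_summable[OF assms]
  have nn: "0 \<le> ?a" "0 \<le> ?b"
    using upper_weight_nonneg[OF r ys] weight_positive[OF ys] r by (auto intro: infsum_nonneg)
  have "cmod (wdelta_sum r g ys) \<le> (\<Sum>\<^sub>\<infinity>x\<in>common_nbrs V m ys.
      cmod (of_real (sqrt (m (Suc r) (x # ys) / m r ys)) * g (oriented (x # ys))))"
    unfolding wdelta_sum_def by (rule norm_infsum_bound) (rule square_summable_mult[OF t(2,1)])
  also have "\<dots> \<le> sqrt ?a * sqrt ?b"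
    using infsum_Cauchy_Schwarz[OF t(2,1)] unfolding t(3) .
  finally have "(cmod (wdelta_sum r g ys))\<^sup>2 \<le> (sqrt ?a * sqrt ?b)\<^sup>2"
    by (intro power_mono) auto
  then show ?thesis using nn by (simp add: power_mult_distrib)
qed

lemma wdelta_bounded:
  assumes r: "r < n" and D: "upper_degree_le r D" and g: "g \<in> l2_space V m (Suc r)"
  shows "wdelta r g \<in> l2_space V m r"
    and "real (r + 2) * square_sum r (wdelta r g) \<le> D * square_sum (Suc r) g"
proof -
  let ?S = "\<lambda>ys. \<Sum>\<^sub>\<infinity>x\<in>common_nbrs V m ys. (cmod (g (oriented (x # ys))))\<^sup>2"
  have gs: "(\<lambda>xs. (cmod (g (oriented xs)))\<^sup>2) summable_on F (Suc r)" and gc: "g \<in> cochains V m (Suc r)"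
    using g by (simp_all add: l2_space_def)
  have bound: "real (r + 2) * (cmod (wdelta r g (oriented ys)))\<^sup>2 \<le> D * ?S ys" if ys: "ys \<in> F r" for ys
  proof -
    have pos: "0 < m r ys" using weight_positive[OF ys] r by simp
    have "real (r + 2) * (cmod (wdelta_sum r g ys))\<^sup>2 \<le> real (r + 2) * (upper_weight r ys / m r ys * ?S ys)"
      by (intro mult_left_mono wdelta_sum_bound r g ys) simp
    also have "\<dots> = (real (r + 2) * upper_weight r ys / m r ys) * ?S ys" by simp
    also have "\<dots> \<le> D * ?S ys"
      using D ys pos by (intro mult_right_mono infsum_nonneg)
        (auto simp: upper_degree_le_def divide_le_eq)
    finally show ?thesis by (simp add: wdelta_oriented[OF r gc ys])
  qed
  have DS: "(\<lambda>ys. D * ?S ys) summable_on F r"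
    by (intro summable_on_cmult_right summable_Cons_outer gs)
  have "(\<lambda>ys. real (r + 2) * (cmod (wdelta r g (oriented ys)))\<^sup>2) summable_on F r"
    using DS bound by (rule summable_on_comparison_test) auto
  then have S: "(\<lambda>ys. (cmod (wdelta r g (oriented ys)))\<^sup>2) summable_on F r"
    by (subst (asm) summable_on_cmult_right') auto
  then show "wdelta r g \<in> l2_space V m r"
    by (simp add: l2_space_def wdelta_cochain r gc)
  have "real (r + 2) * square_sum r (wdelta r g) = (\<Sum>\<^sub>\<infinity>ys\<in>F r. real (r + 2) * (cmod (wdelta r g (oriented ys)))\<^sup>2)"
    by (rule infsum_cmult_right'[symmetric])
  also have "\<dots> \<le> (\<Sum>\<^sub>\<infinity>ys\<in>F r. D * ?S ys)"
    by (intro infsum_mono DS bound summable_on_cmult_right S)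
  also have "\<dots> = D * square_sum (Suc r) g"
    by (simp only: infsum_cmult_right' infsum_Cons[OF gs])
  finally show "real (r + 2) * square_sum r (wdelta r g) \<le> D * square_sum (Suc r) g" .
qed

lemma face_term_bounded:
  assumes r: "r < n" and D: "upper_degree_le r D" and f: "f \<in> l2_space V m r"
  shows "face_term r f square_summable_on F (Suc r)"
    and "real (r + 2) * (\<Sum>\<^sub>\<infinity>xs\<in>F (Suc r). (cmod (face_term r f xs))\<^sup>2) \<le> D * square_sum r f"
proof -
  let ?T = "\<lambda>ys. upper_weight r ys * ((cmod (f (oriented ys)))\<^sup>2 / m r ys)"
  have fs: "(\<lambda>ys. (cmod (f (oriented ys)))\<^sup>2) summable_on F r"
    using f by (simp add: l2_space_def)
  have bound: "real (r + 2) * ?T ys \<le> D * (cmod (f (oriented ys)))\<^sup>2" if ys: "ys \<in> F r" for ys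
  proof -
    have pos: "0 < m r ys" using weight_positive[OF ys] r by simp
    have "real (r + 2) * ?T ys = (real (r + 2) * upper_weight r ys / m r ys) * (cmod (f (oriented ys)))\<^sup>2"
      by simp
    also have "\<dots> \<le> D * (cmod (f (oriented ys)))\<^sup>2"
      using D ys pos by (intro mult_right_mono) (auto simp: upper_degree_le_def divide_le_eq)
    finally show ?thesis .
  qed
  have DS: "(\<lambda>ys. D * (cmod (f (oriented ys)))\<^sup>2) summable_on F r"
    by (intro summable_on_cmult_right fs)
  have "(\<lambda>ys. real (r + 2) * ?T ys) summable_on F r"
    using DS bound
  proof (rule summable_on_comparison_test)
    fix ys assume "ys \<in> F r"
    then show "0 \<le> real (r + 2) * ?T ys"
      using upper_weight_nonneg[OF r, of ys] weight_positive[of ys r] r by simp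
  qed
  then have S: "?T summable_on F r"
    by (subst (asm) summable_on_cmult_right') auto
  then show ft: "face_term r f square_summable_on F (Suc r)"
    by (rule face_term_square_summable[OF r])
  have "real (r + 2) * (\<Sum>\<^sub>\<infinity>xs\<in>F (Suc r). (cmod (face_term r f xs))\<^sup>2)
      = (\<Sum>\<^sub>\<infinity>ys\<in>F r. real (r + 2) * ?T ys)"
    unfolding face_term_infsum[OF r ft] by (rule infsum_cmult_right'[symmetric])
  also have "\<dots> \<le> (\<Sum>\<^sub>\<infinity>ys\<in>F r. D * (cmod (f (oriented ys)))\<^sup>2)"
    by (intro infsum_mono DS bound summable_on_cmult_right S)
  also have "\<dots> = D * square_sum r f"
    by (rule infsum_cmult_right')
  finally show "real (r + 2) * (\<Sum>\<^sub>\<infinity>xs\<in>F (Suc r). (cmod (face_term r f xs))\<^sup>2) \<le> D * square_sum r f" .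
qed

text \<open>
  The two factors \<open>r + 2\<close> from Cauchy-Schwarz over the faces and from the number of faces are
  compensated by the one in the degree and by the one in the normalisation of the norms (see \<open>wcoboundary_norm\<close>).
\<close>
lemma wcoboundary_bounded:
  assumes r: "r < n" and D: "upper_degree_le r D" and f: "f \<in> l2_space V m r"
  shows "wcoboundary r f \<in> l2_space V m (Suc r)"
    and "square_sum (Suc r) (wcoboundary r f) \<le> real (r + 2) * (D * square_sum r f)"
proof -
  note ft = face_term_bounded[OF assms]
  have fc: "f \<in> cochains V m r" using f by (simp add: l2_space_def)
  show l2: "wcoboundary r f \<in> l2_space V m (Suc r)"
    by (rule wcoboundary_l2[OF r fc ft(1)])
  have sm: "(\<lambda>xs. (cmod (face_term r f (to_front i xs)))\<^sup>2) summable_on F (Suc r)" if "i \<le> Suc r" for i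
    using face_term_to_front_square_summable[OF ft(1) that] by (simp add: square_summable_on_def)
  have S: "(\<lambda>xs. real (r + 2) * (\<Sum>i\<le>Suc r. (cmod (face_term r f (to_front i xs)))\<^sup>2)) summable_on F (Suc r)"
    by (intro summable_on_cmult_right summable_on_finite_sum) (auto intro: sm)
  have "square_sum (Suc r) (wcoboundary r f)
      \<le> (\<Sum>\<^sub>\<infinity>xs\<in>F (Suc r). real (r + 2) * (\<Sum>i\<le>Suc r. (cmod (face_term r f (to_front i xs)))\<^sup>2))"
  proof (rule infsum_mono[OF _ S])
    show "(\<lambda>xs. (cmod (wcoboundary r f (oriented xs)))\<^sup>2) summable_on F (Suc r)"
      using l2 by (simp add: l2_space_def)
    fix xs assume xs: "xs \<in> F (Suc r)"
    have "cmod (wcoboundary r f (oriented xs)) \<le> (\<Sum>i\<le>Suc r. cmod (face_term r f (to_front i xs)))"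
      unfolding wcoboundary_oriented[OF r fc xs] wcoboundary_sum_def
      by (rule order.trans[OF norm_sum]) (simp add: norm_mult norm_power del: sum.atMost_Suc)
    then have "(cmod (wcoboundary r f (oriented xs)))\<^sup>2 \<le> (\<Sum>i\<le>Suc r. cmod (face_term r f (to_front i xs)))\<^sup>2"
      by (intro power_mono) auto
    also have "\<dots> \<le> (\<Sum>i\<le>Suc r. (cmod (face_term r f (to_front i xs)))\<^sup>2) * real (card {..Suc r})"
      by (rule sum_squared_le_sum_of_squares)
    finally show "(cmod (wcoboundary r f (oriented xs)))\<^sup>2
        \<le> real (r + 2) * (\<Sum>i\<le>Suc r. (cmod (face_term r f (to_front i xs)))\<^sup>2)"
      by (simp add: mult.commute del: sum.atMost_Suc)
  qed
  also have "\<dots> = real (r + 2) * (\<Sum>i\<le>Suc r. \<Sum>\<^sub>\<infinity>xs\<in>F (Suc r). (cmod (face_term r f (to_front i xs)))\<^sup>2)"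
    by (subst infsum_cmult_right', subst infsum_finite_sum) (auto intro: sm)
  also have "\<dots> = real (r + 2) * (\<Sum>i\<le>Suc r. \<Sum>\<^sub>\<infinity>xs\<in>F (Suc r). (cmod (face_term r f xs))\<^sup>2)"
    using infsum_reindex_bij_betw[OF bij_betw_to_front, where f = "\<lambda>xs. (cmod (face_term r f xs))\<^sup>2"]
    by (intro arg_cong2[where f = "(*)"] sum.cong refl) auto
  also have "\<dots> = real (r + 2) * (real (r + 2) * (\<Sum>\<^sub>\<infinity>xs\<in>F (Suc r). (cmod (face_term r f xs))\<^sup>2))"
    by (simp del: sum.atMost_Suc)
  also have "\<dots> \<le> real (r + 2) * (D * square_sum r f)"
    using ft(2) by (intro mult_left_mono) auto
  finally show "square_sum (Suc r) (wcoboundary r f) \<le> real (r + 2) * (D * square_sum r f)" .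
qed

section \<open>The space of square summable cochains\<close>

lemma l2_inner_self:
  assumes "f \<in> l2_space V m k"
  shows "l2_inner V m k f f = of_real (square_sum k f / fact (k + 1))"
proof -
  have "(\<Sum>\<^sub>\<infinity>xs\<in>F k. f (oriented xs) * cnj (f (oriented xs))) = of_real (square_sum k f)"
    unfolding complex_norm_square[symmetric]
    using assms by (intro infsumI has_sum_of_real has_sum_infsum) (simp add: l2_space_def)
  then show ?thesis by (simp add: l2_inner_def)
qed

lemma l2_norm_eq: "f \<in> l2_space V m k \<Longrightarrow> l2_norm V m k f = sqrt (square_sum k f / fact (k + 1))"
  by (simp only: l2_norm_def l2_inner_self Re_complex_of_real)

lemma l2_norm_square: "f \<in> l2_space V m k \<Longrightarrow> (l2_norm V m k f)\<^sup>2 = square_sum k f / fact (k + 1)"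
  by (simp add: l2_norm_eq infsum_nonneg del: fact_Suc)

lemma l2_norm_nonneg: "f \<in> l2_space V m k \<Longrightarrow> 0 \<le> l2_norm V m k f"
  by (simp add: l2_norm_eq infsum_nonneg del: fact_Suc)

lemma l2_norm_le_zero_imp:
  assumes f: "f \<in> l2_space V m k" and le: "l2_norm V m k f \<le> 0"
  shows "f = (\<lambda>\<sigma>. 0)"
proof
  fix \<sigma>
  have "square_sum k f \<le> 0"
    using le fact_gt_zero[of "k + 1", where 'a = real]
    by (simp add: l2_norm_eq[OF f] divide_le_0_iff not_le del: fact_Suc fact_gt_zero)
  then have "(cmod (f (oriented xs)))\<^sup>2 = 0" if "xs \<in> F k" for xs
    by (rule nonneg_infsum_le_0D) (use f that in \<open>auto simp: l2_space_def\<close>)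
  then show "f \<sigma> = 0"
    using f by (cases "\<sigma> \<in> oriented_simplices V m k") (auto simp: oriented_simplices_def l2_space_def cochains_iff)
qed

lemma l2_inner_commute: "l2_inner V m k f g = cnj (l2_inner V m k g f)"
  unfolding l2_inner_def complex_cnj_mult infsum_cnj[symmetric] by (simp add: mult.commute)

lemma l2_inner_summable:
  "f \<in> l2_space V m k \<Longrightarrow> g \<in> l2_space V m k \<Longrightarrow> (\<lambda>xs. f (oriented xs) * cnj (g (oriented xs))) summable_on F k"
  by (rule Infinite_Sum.abs_summable_summable, rule square_summable_mult)
    (simp_all add: l2_space_iff square_summable_on_def)

lemma l2_inner_add:
  assumes "(\<lambda>xs. f (oriented xs) * cnj (h (oriented xs))) summable_on F k"
    "(\<lambda>xs. g (oriented xs) * cnj (h (oriented xs))) summable_on F k"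
  shows "l2_inner V m k (\<lambda>\<sigma>. f \<sigma> + g \<sigma>) h = l2_inner V m k f h + l2_inner V m k g h"
  unfolding l2_inner_def distrib_right infsum_add[OF assms] distrib_left ..

lemma cochains_linear:
  assumes "f \<in> cochains V m k" "g \<in> cochains V m k"
  shows "(\<lambda>\<sigma>. a * f \<sigma> + b * g \<sigma>) \<in> cochains V m k"
  using assms unfolding cochains_iff alternating_on_def by (auto simp: algebra_simps)

lemma l2_space_linear:
  assumes "f \<in> l2_space V m k" "g \<in> l2_space V m k"
  shows "(\<lambda>\<sigma>. a * f \<sigma> + b * g \<sigma>) \<in> l2_space V m k"
  using assms cochains_linear unfolding l2_space_iff
  by (auto intro!: square_summable_add square_summable_scale)

lemma l2_space_add:
  "f \<in> l2_space V m k \<Longrightarrow> g \<in> l2_space V m k \<Longrightarrow> (\<lambda>\<sigma>. f \<sigma> + g \<sigma>) \<in> l2_space V m k"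
  using l2_space_linear[of f k g 1 1] by simp

lemma l2_space_diff:
  "f \<in> l2_space V m k \<Longrightarrow> g \<in> l2_space V m k \<Longrightarrow> (\<lambda>\<sigma>. f \<sigma> - g \<sigma>) \<in> l2_space V m k"
  using l2_space_linear[of f k g 1 "-1"] by simp

lemma l2_norm_triangle:
  assumes f: "f \<in> l2_space V m k" and g: "g \<in> l2_space V m k"
  shows "l2_norm V m k (\<lambda>\<sigma>. f \<sigma> + g \<sigma>) \<le> l2_norm V m k f + l2_norm V m k g"
  using infsum_Minkowski[of "\<lambda>xs. f (oriented xs)" "F k" "\<lambda>xs. g (oriented xs)"] f g
  unfolding l2_norm_eq[OF l2_space_add[OF f g]] l2_norm_eq[OF f] l2_norm_eq[OF g]
  by (simp add: l2_space_iff real_sqrt_divide divide_right_mono add_divide_distrib[symmetric] del: fact_Suc)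

lemma l2_norm_minus: "l2_norm V m k (\<lambda>\<sigma>. - f \<sigma>) = l2_norm V m k f"
  by (simp add: l2_norm_def l2_inner_def)

lemma zero_l2: "(\<lambda>\<sigma>. 0) \<in> l2_space V m k" "l2_norm V m k (\<lambda>\<sigma>. 0) = 0"
  by (simp_all add: l2_space_def cochains_iff alternating_on_def l2_norm_def l2_inner_def)

lemma wcoboundary_norm:
  assumes r: "r < n" and D: "upper_degree_le r D" and f: "f \<in> l2_space V m r"
  shows "(l2_norm V m (Suc r) (wcoboundary r f))\<^sup>2 \<le> D * (l2_norm V m r f)\<^sup>2"
proof -
  have "square_sum (Suc r) (wcoboundary r f) / fact (Suc r + 1) \<le> real (r + 2) * (D * square_sum r f) / fact (Suc r + 1)"
    by (intro divide_right_mono wcoboundary_bounded[OF assms]) simp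
  also have "\<dots> = D * (square_sum r f / fact (r + 1))"
    unfolding fact_Suc_Suc by (simp del: fact_Suc)
  finally show ?thesis
    by (simp only: l2_norm_square[OF f] l2_norm_square[OF wcoboundary_bounded(1)[OF assms]])
qed

lemma wdelta_norm:
  assumes r: "r < n" and D: "upper_degree_le r D" and g: "g \<in> l2_space V m (Suc r)"
  shows "(l2_norm V m r (wdelta r g))\<^sup>2 \<le> D * (l2_norm V m (Suc r) g)\<^sup>2"
proof -
  have "square_sum r (wdelta r g) / fact (r + 1) = real (r + 2) * square_sum r (wdelta r g) / fact (Suc r + 1)"
    unfolding fact_Suc_Suc by (simp del: fact_Suc)
  also have "\<dots> \<le> D * square_sum (Suc r) g / fact (Suc r + 1)"
    by (intro divide_right_mono wdelta_bounded[OF assms]) simp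
  finally show ?thesis
    by (simp only: l2_norm_square[OF g] l2_norm_square[OF wdelta_bounded(1)[OF assms]] times_divide_eq_right)
qed

lemma finite_support:
  assumes "u \<in> cochains_fin V m k"
  shows "finite {xs \<in> F k. u (oriented xs) \<noteq> 0}"
proof (rule finite_subset)
  show "{xs \<in> F k. u (oriented xs) \<noteq> 0} \<subseteq> \<Union> {\<sigma> \<in> oriented_simplices V m k. u \<sigma> \<noteq> 0}"
  proof
    fix xs assume "xs \<in> {xs \<in> F k. u (oriented xs) \<noteq> 0}"
    then show "xs \<in> \<Union> {\<sigma> \<in> oriented_simplices V m k. u \<sigma> \<noteq> 0}"
      using in_oriented[of xs] by (intro UnionI[of "oriented xs"]) auto
  qed
  show "finite (\<Union> {\<sigma> \<in> oriented_simplices V m k. u \<sigma> \<noteq> 0})"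
    using assms finite_oriented by (intro finite_Union) (auto simp: cochains_fin_def oriented_simplices_def)
qed

lemma cochains_finI:
  assumes "u \<in> cochains V m k" "finite X" "\<And>xs. xs \<in> F k \<Longrightarrow> u (oriented xs) \<noteq> 0 \<Longrightarrow> oriented xs \<in> X"
  shows "u \<in> cochains_fin V m k"
proof -
  have "{\<sigma> \<in> oriented_simplices V m k. u \<sigma> \<noteq> 0} \<subseteq> X"
    using assms(3) by (auto simp: oriented_simplices_def)
  with assms show ?thesis
    by (simp add: cochains_fin_def finite_subset)
qed

lemma fin_summable:
  assumes "u \<in> cochains_fin V m k" "\<And>xs. xs \<in> F k \<Longrightarrow> u (oriented xs) = 0 \<Longrightarrow> \<phi> xs = 0"
  shows "\<phi> summable_on F k"
proof (rule finite_nonzero_values_imp_summable_on)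
  have "{xs \<in> F k. \<phi> xs \<noteq> 0} \<subseteq> {xs \<in> F k. u (oriented xs) \<noteq> 0}"
    using assms(2) by blast
  then show "finite {xs \<in> F k. \<phi> xs \<noteq> 0}"
    using finite_support[OF assms(1)] by (rule finite_subset)
qed

lemma fin_cochain: "u \<in> cochains_fin V m k \<Longrightarrow> u \<in> cochains V m k"
  by (simp add: cochains_fin_def)

lemma fin_l2: "u \<in> cochains_fin V m k \<Longrightarrow> u \<in> l2_space V m k"
  unfolding l2_space_def by (intro CollectI conjI fin_cochain fin_summable[of u k]) auto

lemma fin_face_term:
  "r < n \<Longrightarrow> u \<in> cochains_fin V m r \<Longrightarrow> face_term r u square_summable_on F (Suc r)"
  by (rule face_term_square_summable, assumption, rule fin_summable, assumption) simp

text \<open>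
  A simplex \<open>ys\<close> at which \<open>wdelta r g\<close> does not vanish is a face of a simplex in the support of \<open>g\<close>.
  (The corresponding statement for \<open>wcoboundary\<close> fails without local finiteness.)
\<close>
lemma wdelta_fin:
  assumes r: "r < n" and g: "g \<in> cochains_fin V m (Suc r)"
  shows "wdelta r g \<in> cochains_fin V m r"
proof (rule cochains_finI)
  show "wdelta r g \<in> cochains V m r" by (rule wdelta_cochain[OF r fin_cochain[OF g]])
  show "finite (oriented ` tl ` {xs \<in> F (Suc r). g (oriented xs) \<noteq> 0})"
    by (intro finite_imageI finite_support g)
  fix ys assume ys: "ys \<in> F r" and "wdelta r g (oriented ys) \<noteq> 0"
  then have "wdelta_sum r g ys \<noteq> 0"
    by (simp add: wdelta_oriented[OF r fin_cochain[OF g]])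
  moreover have "wdelta_sum r g ys = 0" if "\<forall>x\<in>common_nbrs V m ys. g (oriented (x # ys)) = 0"
    unfolding wdelta_sum_def using that by (intro infsum_0) simp
  ultimately obtain x where "x \<in> common_nbrs V m ys" "g (oriented (x # ys)) \<noteq> 0"
    by blast
  then have "x # ys \<in> {xs \<in> F (Suc r). g (oriented xs) \<noteq> 0}"
    using ys by (simp add: Cons_in_simplices_iff)
  then show "oriented ys \<in> oriented ` tl ` {xs \<in> F (Suc r). g (oriented xs) \<noteq> 0}"
    by (auto intro!: image_eqI[of _ _ ys] image_eqI[of _ tl "x # ys"])
qed

lemma wcoboundary_fin_l2: "r < n \<Longrightarrow> u \<in> cochains_fin V m r \<Longrightarrow> wcoboundary r u \<in> l2_space V m (Suc r)"
  by (intro wcoboundary_l2 fin_cochain fin_face_term)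

lemma LL_up_form:
  assumes r: "r < n" and u: "u \<in> cochains_fin V m r"
  shows "l2_inner V m r (LL_up V n m r u) u = of_real ((l2_norm V m (Suc r) (wcoboundary r u))\<^sup>2)"
proof -
  have "l2_inner V m r (LL_up V n m r u) u = cnj (l2_inner V m (Suc r) (wcoboundary r u) (wcoboundary r u))"
    unfolding LL_up_eq[OF r] adjoint[OF r fin_cochain[OF u] fin_face_term[OF r u] wcoboundary_fin_l2[OF r u]]
    by (rule l2_inner_commute)
  then show ?thesis
    by (simp only: l2_inner_self[OF wcoboundary_fin_l2[OF r u]] l2_norm_square[OF wcoboundary_fin_l2[OF r u]]
        complex_cnj_complex_of_real)
qed

lemma LL_down_form:
  assumes r: "r < n" and u: "u \<in> cochains_fin V m (Suc r)"
  shows "l2_inner V m (Suc r) (LL_down V n m (Suc r) u) u = of_real ((l2_norm V m r (wdelta r u))\<^sup>2)"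
proof -
  note w = wdelta_fin[OF r u]
  show ?thesis
    unfolding LL_down_Suc[OF r] adjoint[OF r fin_cochain[OF w] fin_face_term[OF r w] fin_l2[OF u]]
    by (simp only: l2_inner_self[OF fin_l2[OF w]] l2_norm_square[OF fin_l2[OF w]])
qed

section \<open>Bounded symmetric operators\<close>

lemma wcoboundary_linear:
  assumes r: "r < n"
  shows "wcoboundary r (\<lambda>\<sigma>. a * f \<sigma> + b * g \<sigma>) = (\<lambda>\<sigma>. a * wcoboundary r f \<sigma> + b * wcoboundary r g \<sigma>)"
proof -
  have "wcoboundary_sum r (\<lambda>\<sigma>. a * f \<sigma> + b * g \<sigma>) xs = a * wcoboundary_sum r f xs + b * wcoboundary_sum r g xs" for xs
    unfolding wcoboundary_sum_def face_term_def sum_distrib_left sum.distrib[symmetric]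
    by (intro sum.cong refl) (simp add: algebra_simps)
  then show ?thesis
    unfolding wcoboundary_eq[OF r] cochain_of_def by auto
qed

lemma wdelta_linear:
  assumes r: "r < n" and f: "f \<in> l2_space V m (Suc r)" and g: "g \<in> l2_space V m (Suc r)"
  shows "wdelta r (\<lambda>\<sigma>. a * f \<sigma> + b * g \<sigma>) = (\<lambda>\<sigma>. a * wdelta r f \<sigma> + b * wdelta r g \<sigma>)"
proof -
  have "wdelta_sum r (\<lambda>\<sigma>. a * f \<sigma> + b * g \<sigma>) ys = a * wdelta_sum r f ys + b * wdelta_sum r g ys"
    if ys: "ys \<in> F r" for ys
  proof -
    let ?w = "\<lambda>x. complex_of_real (sqrt (m (Suc r) (x # ys) / m r ys))"
    have "wdelta_sum r (\<lambda>\<sigma>. a * f \<sigma> + b * g \<sigma>) ys = (\<Sum>\<^sub>\<infinity>x\<in>common_nbrs V m ys.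
        a * (?w x * f (oriented (x # ys))) + b * (?w x * g (oriented (x # ys))))"
      unfolding wdelta_sum_def by (intro infsum_cong) (simp add: algebra_simps)
    also have "\<dots> = (\<Sum>\<^sub>\<infinity>x\<in>common_nbrs V m ys. a * (?w x * f (oriented (x # ys))))
        + (\<Sum>\<^sub>\<infinity>x\<in>common_nbrs V m ys. b * (?w x * g (oriented (x # ys))))"
      by (intro infsum_add summable_on_cmult_right wdelta_sum_summable r f g ys)
    finally show ?thesis
      unfolding infsum_cmult_right' wdelta_sum_def[symmetric] .
  qed
  then show ?thesis
    unfolding wdelta_eq[OF r] cochain_of_def using rep_in by auto
qed

text \<open>
  Keeps the bound explicit, so that the bounds of the two halves of the Laplacian can be added.
\<close>
definition symmetric_bounded_by ::
    "nat \<Rightarrow> real \<Rightarrow> (('v list set \<Rightarrow> complex) \<Rightarrow> 'v list set \<Rightarrow> complex) \<Rightarrow> bool" where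
  "symmetric_bounded_by k D A \<longleftrightarrow>
     (\<forall>f\<in>l2_space V m k. A f \<in> l2_space V m k \<and> l2_norm V m k (A f) \<le> D * l2_norm V m k f) \<and>
     (\<forall>f\<in>l2_space V m k. \<forall>g\<in>l2_space V m k. \<forall>a b.
        A (\<lambda>\<sigma>. a * f \<sigma> + b * g \<sigma>) = (\<lambda>\<sigma>. a * A f \<sigma> + b * A g \<sigma>)) \<and>
     l2_self_adjoint V m k A"

lemma symmetric_bounded_by_zero: "symmetric_bounded_by k 0 (\<lambda>f \<sigma>. 0)"
  by (simp add: symmetric_bounded_by_def zero_l2 l2_self_adjoint_def l2_inner_def)

lemma symmetric_bounded_by_add:
  assumes A: "symmetric_bounded_by k C A" and B: "symmetric_bounded_by k D B"
  shows "symmetric_bounded_by k (C + D) (\<lambda>f \<sigma>. A f \<sigma> + B f \<sigma>)"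
  unfolding symmetric_bounded_by_def
proof (intro conjI ballI allI)
  fix f assume f: "f \<in> l2_space V m k"
  then have Af: "A f \<in> l2_space V m k" "l2_norm V m k (A f) \<le> C * l2_norm V m k f"
    and Bf: "B f \<in> l2_space V m k" "l2_norm V m k (B f) \<le> D * l2_norm V m k f"
    using A B by (simp_all add: symmetric_bounded_by_def)
  show "(\<lambda>\<sigma>. A f \<sigma> + B f \<sigma>) \<in> l2_space V m k"
    by (rule l2_space_add[OF Af(1) Bf(1)])
  show "l2_norm V m k (\<lambda>\<sigma>. A f \<sigma> + B f \<sigma>) \<le> (C + D) * l2_norm V m k f"
    using l2_norm_triangle[OF Af(1) Bf(1)] Af(2) Bf(2) by (simp add: distrib_right)
  fix g a b assume g: "g \<in> l2_space V m k"
  then have "A (\<lambda>\<sigma>. a * f \<sigma> + b * g \<sigma>) = (\<lambda>\<sigma>. a * A f \<sigma> + b * A g \<sigma>)"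
    "B (\<lambda>\<sigma>. a * f \<sigma> + b * g \<sigma>) = (\<lambda>\<sigma>. a * B f \<sigma> + b * B g \<sigma>)"
    using A B f by (simp_all add: symmetric_bounded_by_def)
  then show "(\<lambda>\<sigma>. A (\<lambda>\<sigma>. a * f \<sigma> + b * g \<sigma>) \<sigma> + B (\<lambda>\<sigma>. a * f \<sigma> + b * g \<sigma>) \<sigma>)
      = (\<lambda>\<sigma>. a * (A f \<sigma> + B f \<sigma>) + b * (A g \<sigma> + B g \<sigma>))"
    by (simp add: algebra_simps)
next
  show "l2_self_adjoint V m k (\<lambda>f \<sigma>. A f \<sigma> + B f \<sigma>)"
    unfolding l2_self_adjoint_def
  proof (intro ballI)
    fix f g assume fg: "f \<in> l2_space V m k" "g \<in> l2_space V m k"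
    then have l2: "A f \<in> l2_space V m k" "B f \<in> l2_space V m k" "A g \<in> l2_space V m k" "B g \<in> l2_space V m k"
      and adj: "l2_inner V m k (A f) g = l2_inner V m k f (A g)" "l2_inner V m k (B f) g = l2_inner V m k f (B g)"
      using A B by (simp_all add: symmetric_bounded_by_def l2_self_adjoint_def)
    have add: "l2_inner V m k (\<lambda>\<sigma>. p \<sigma> + q \<sigma>) h = l2_inner V m k p h + l2_inner V m k q h"
      if "p \<in> l2_space V m k" "q \<in> l2_space V m k" "h \<in> l2_space V m k" for p q h
      by (intro l2_inner_add l2_inner_summable that)
    have "l2_inner V m k f (\<lambda>\<sigma>. A g \<sigma> + B g \<sigma>) = l2_inner V m k f (A g) + l2_inner V m k f (B g)"
      unfolding l2_inner_commute[of k f] add[OF l2(3,4) fg(1)] by simp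
    then show "l2_inner V m k (\<lambda>\<sigma>. A f \<sigma> + B f \<sigma>) g = l2_inner V m k f (\<lambda>\<sigma>. A g \<sigma> + B g \<sigma>)"
      by (simp add: add l2 fg adj)
  qed
qed

lemma symmetric_bounded_by_LL_down:
  assumes r: "r < n" and D: "upper_degree_le r D"
  shows "symmetric_bounded_by (Suc r) D (LL_down V n m (Suc r))"
proof -
  have delta: "wdelta r f \<in> l2_space V m r" if "f \<in> l2_space V m (Suc r)" for f
    using wdelta_bounded(1)[OF r D that] .
  have d: "wcoboundary r f \<in> l2_space V m (Suc r)" if "f \<in> l2_space V m r" for f
    using wcoboundary_bounded(1)[OF r D that] .
  have adj: "l2_inner V m (Suc r) (wcoboundary r f) g = l2_inner V m r f (wdelta r g)"
    if "f \<in> l2_space V m r" "g \<in> l2_space V m (Suc r)" for f g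
    using that adjoint[OF r _ face_term_bounded(1)[OF r D]] by (simp add: l2_space_iff)
  show ?thesis
    unfolding symmetric_bounded_by_def LL_down_Suc[OF r] l2_self_adjoint_def
  proof (intro conjI ballI allI)
    fix f assume f: "f \<in> l2_space V m (Suc r)"
    show "wcoboundary r (wdelta r f) \<in> l2_space V m (Suc r)" by (intro d delta f)
    show "l2_norm V m (Suc r) (wcoboundary r (wdelta r f)) \<le> D * l2_norm V m (Suc r) f"
      using D by (intro norm_le_if_factor[OF wcoboundary_norm[OF r D delta[OF f]] wdelta_norm[OF r D f]] l2_norm_nonneg f)
        (simp add: upper_degree_le_def)
    fix g assume g: "g \<in> l2_space V m (Suc r)"
    show "wcoboundary r (wdelta r (\<lambda>\<sigma>. a * f \<sigma> + b * g \<sigma>)) = (\<lambda>\<sigma>. a * wcoboundary r (wdelta r f) \<sigma> + b * wcoboundary r (wdelta r g) \<sigma>)" for a b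
      unfolding wdelta_linear[OF r f g] by (rule wcoboundary_linear[OF r])
    have "l2_inner V m (Suc r) f (wcoboundary r (wdelta r g)) = cnj (l2_inner V m r (wdelta r g) (wdelta r f))"
      unfolding l2_inner_commute[of "Suc r" f] adj[OF delta[OF g] f] ..
    then show "l2_inner V m (Suc r) (wcoboundary r (wdelta r f)) g = l2_inner V m (Suc r) f (wcoboundary r (wdelta r g))"
      unfolding adj[OF delta[OF f] g] l2_inner_commute[of r "wdelta r f"] by simp
  qed
qed

lemma symmetric_bounded_by_LL_up:
  assumes r: "r < n" and D: "upper_degree_le r D"
  shows "symmetric_bounded_by r D (LL_up V n m r)"
proof -
  have delta: "wdelta r f \<in> l2_space V m r" if "f \<in> l2_space V m (Suc r)" for f
    using wdelta_bounded(1)[OF r D that] .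
  have d: "wcoboundary r f \<in> l2_space V m (Suc r)" if "f \<in> l2_space V m r" for f
    using wcoboundary_bounded(1)[OF r D that] .
  have adj: "l2_inner V m (Suc r) (wcoboundary r f) g = l2_inner V m r f (wdelta r g)"
    if "f \<in> l2_space V m r" "g \<in> l2_space V m (Suc r)" for f g
    using that adjoint[OF r _ face_term_bounded(1)[OF r D]] by (simp add: l2_space_iff)
  show ?thesis
    unfolding symmetric_bounded_by_def LL_up_eq[OF r] l2_self_adjoint_def
  proof (intro conjI ballI allI)
    fix f assume f: "f \<in> l2_space V m r"
    show "wdelta r (wcoboundary r f) \<in> l2_space V m r" by (intro d delta f)
    show "l2_norm V m r (wdelta r (wcoboundary r f)) \<le> D * l2_norm V m r f"
      using D by (intro norm_le_if_factor[OF wdelta_norm[OF r D d[OF f]] wcoboundary_norm[OF r D f]] l2_norm_nonneg f)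
        (simp add: upper_degree_le_def)
    fix g assume g: "g \<in> l2_space V m r"
    show "wdelta r (wcoboundary r (\<lambda>\<sigma>. a * f \<sigma> + b * g \<sigma>)) = (\<lambda>\<sigma>. a * wdelta r (wcoboundary r f) \<sigma> + b * wdelta r (wcoboundary r g) \<sigma>)" for a b
      unfolding wcoboundary_linear[OF r] by (rule wdelta_linear[OF r d[OF f] d[OF g]])
    show "l2_inner V m r (wdelta r (wcoboundary r f)) g = l2_inner V m r f (wdelta r (wcoboundary r g))"
      unfolding adj[OF f d[OF g], symmetric] l2_inner_commute[of r _ g] adj[OF g d[OF f], symmetric]
      by (rule l2_inner_commute[symmetric])
  qed
qed

section \<open>Density and uniqueness of the extension\<close>

lemma cochains_fin_dense:
  assumes f: "f \<in> l2_space V m k" and e: "0 < e"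
  obtains u where "u \<in> cochains_fin V m k" "l2_norm V m k (\<lambda>\<sigma>. f \<sigma> - u \<sigma>) \<le> e"
proof -
  let ?sq = "\<lambda>xs. (cmod (f (oriented xs)))\<^sup>2" and ?c = "e\<^sup>2 * fact (k + 1)"
  have fs: "?sq summable_on F k" and fc: "f \<in> cochains V m k"
    using f by (simp_all add: l2_space_def)
  have "0 < ?c" using e by (intro mult_pos_pos zero_less_power fact_gt_zero)
  then obtain X where X: "finite X" "X \<subseteq> F k" "dist (sum ?sq X) (infsum ?sq (F k)) \<le> ?c"
    using infsum_finite_approximation[OF fs] by blast
  \<comment> \<open>Truncating to the vertex sets of the members of \<open>X\<close>, instead of \<open>X\<close> itself, keeps \<open>u\<close> alternating.\<close>
  define u where "u \<sigma> = (if mset (rep \<sigma>) \<in> mset ` X then f \<sigma> else 0)" for \<sigma>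
  have u: "u (oriented xs) = (if mset xs \<in> mset ` X then f (oriented xs) else 0)" for xs
    by (simp add: u_def mset_rep_oriented)
  have "u \<in> cochains V m k"
    using fc unfolding cochains_iff alternating_on_def u by (auto simp: u_def add_mset_commute)
  then have ufin: "u \<in> cochains_fin V m k"
  proof (rule cochains_finI)
    show "finite (oriented ` (\<Union>A\<in>mset ` X. permutations_of_multiset A))"
      using X by (intro finite_imageI finite_UN_I) auto
    show "oriented xs \<in> oriented ` (\<Union>A\<in>mset ` X. permutations_of_multiset A)"
      if "u (oriented xs) \<noteq> 0" for xs
    proof -
      have "mset xs \<in> mset ` X" using that by (simp add: u split: if_splits)
      moreover have "xs \<in> permutations_of_multiset (mset xs)"
        by (simp add: permutations_of_multiset_def)
      ultimately show ?thesis by blast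
    qed
  qed
  have "square_sum k (\<lambda>\<sigma>. f \<sigma> - u \<sigma>) \<le> infsum ?sq (F k - X)"
  proof (rule infsum_mono_neutral)
    show "(\<lambda>xs. (cmod (f (oriented xs) - u (oriented xs)))\<^sup>2) summable_on F k"
      using l2_space_diff[OF f fin_l2[OF ufin]] by (simp add: l2_space_def)
    show "?sq summable_on (F k - X)"
      by (rule summable_on_subset_banach[OF fs]) auto
  qed (auto simp: u)
  also have "\<dots> = infsum ?sq (F k) - sum ?sq X"
    using X fs by (subst infsum_Diff) auto
  also have "\<dots> \<le> ?c"
    using X(3) by (simp add: dist_real_def)
  finally have "l2_norm V m k (\<lambda>\<sigma>. f \<sigma> - u \<sigma>) \<le> sqrt (?c / fact (k + 1))"
    unfolding l2_norm_eq[OF l2_space_diff[OF f fin_l2[OF ufin]]]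
    by (intro real_sqrt_le_mono divide_right_mono) auto
  also have "\<dots> = e"
    using e by (simp del: fact_Suc)
  finally show ?thesis using that ufin by blast
qed

lemma bounded_op_unique:
  assumes A: "l2_bounded_op V m k A" and B: "l2_bounded_op V m k B"
    and eq: "\<And>u. u \<in> cochains_fin V m k \<Longrightarrow> B u = A u" and f: "f \<in> l2_space V m k"
  shows "B f = A f"
proof -
  obtain C1 where C1: "\<And>f. f \<in> l2_space V m k \<Longrightarrow> l2_norm V m k (A f) \<le> C1 * l2_norm V m k f"
    using A unfolding l2_bounded_op_def by blast
  obtain C2 where C2: "\<And>f. f \<in> l2_space V m k \<Longrightarrow> l2_norm V m k (B f) \<le> C2 * l2_norm V m k f"
    using B unfolding l2_bounded_op_def by blast
  have l2: "A g \<in> l2_space V m k" "B g \<in> l2_space V m k" if "g \<in> l2_space V m k" for g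
    using A B that by (simp_all add: l2_bounded_op_def)
  have diff: "T (\<lambda>\<sigma>. f \<sigma> - u \<sigma>) = (\<lambda>\<sigma>. T f \<sigma> - T u \<sigma>)"
    if "l2_bounded_op V m k T" "u \<in> l2_space V m k" for T u
  proof -
    have "T (\<lambda>\<sigma>. 1 * f \<sigma> + (-1) * u \<sigma>) = (\<lambda>\<sigma>. 1 * T f \<sigma> + (-1) * T u \<sigma>)"
      using that f unfolding l2_bounded_op_def by blast
    then show ?thesis by simp
  qed
  define h where "h \<sigma> = B f \<sigma> - A f \<sigma>" for \<sigma>
  define C where "C = \<bar>C1\<bar> + \<bar>C2\<bar> + 1"
  have h: "h \<in> l2_space V m k"
    unfolding h_def by (intro l2_space_diff l2 f)
  have "l2_norm V m k h \<le> 0 + e" if e: "0 < e" for e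
  proof -
    have C: "0 < C" by (simp add: C_def)
    with e have "0 < e / C" by simp
    then obtain u where u: "u \<in> cochains_fin V m k" "l2_norm V m k (\<lambda>\<sigma>. f \<sigma> - u \<sigma>) \<le> e / C"
      by (rule cochains_fin_dense[OF f])
    let ?g = "\<lambda>\<sigma>. f \<sigma> - u \<sigma>"
    have g: "?g \<in> l2_space V m k" by (intro l2_space_diff f fin_l2 u)
    have h_eq: "h = (\<lambda>\<sigma>. B ?g \<sigma> + - A ?g \<sigma>)"
    proof
      fix \<sigma>
      show "h \<sigma> = B ?g \<sigma> + - A ?g \<sigma>"
        unfolding diff[OF A fin_l2[OF u(1)]] diff[OF B fin_l2[OF u(1)]] eq[OF u(1)] h_def by simp
    qed
    have "(\<lambda>\<sigma>. - A ?g \<sigma>) \<in> l2_space V m k"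
      using l2_space_linear[OF l2(1)[OF g] l2(1)[OF g], of "-1" 0] by simp
    then have "l2_norm V m k h \<le> l2_norm V m k (B ?g) + l2_norm V m k (\<lambda>\<sigma>. - A ?g \<sigma>)"
      unfolding h_eq by (rule l2_norm_triangle[OF l2(2)[OF g]])
    also have "\<dots> \<le> C2 * l2_norm V m k ?g + C1 * l2_norm V m k ?g"
      unfolding l2_norm_minus by (intro add_mono C1 C2 g)
    also have "\<dots> \<le> C * l2_norm V m k ?g"
      unfolding C_def distrib_right[symmetric] by (intro mult_right_mono l2_norm_nonneg g) linarith
    also have "\<dots> \<le> C * (e / C)"
      using C u by (intro mult_left_mono) auto
    finally show ?thesis using C by simp
  qed
  then have "l2_norm V m k h \<le> 0"
    by (rule field_le_epsilon)
  then have "h = (\<lambda>\<sigma>. 0)"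
    by (rule l2_norm_le_zero_imp[OF h])
  then show ?thesis
    unfolding h_def fun_eq_iff by simp
qed

section \<open>The quadratic forms\<close>

definition form_bounded_by :: "nat \<Rightarrow> ennreal \<Rightarrow> (('v list set \<Rightarrow> complex) \<Rightarrow> 'v list set \<Rightarrow> complex) \<Rightarrow> bool" where
  "form_bounded_by k D A \<longleftrightarrow> (\<forall>u\<in>cochains_fin V m k.
     l2_inner V m k (A u) u \<in> \<real> \<and>
     ereal (Re (l2_inner V m k (A u) u)) \<le> enn2ereal D * ereal ((l2_norm V m k u)\<^sup>2))"

text \<open>
  For \<open>D = \<infinity>\<close> and \<open>u \<noteq> 0\<close> the right-hand side is infinite, and for \<open>u = 0\<close> it is \<open>\<infinity> \<cdot> 0 = 0\<close>, which
  is the value of the form. An estimate is called for only when \<open>D\<close> is finite.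
\<close>
lemma form_bounded_byI:
  assumes real: "\<And>u. u \<in> cochains_fin V m k \<Longrightarrow> l2_inner V m k (A u) u = of_real (q u)"
    and le: "\<And>u. u \<in> cochains_fin V m k \<Longrightarrow> D < \<infinity> \<Longrightarrow> q u \<le> enn2real D * (l2_norm V m k u)\<^sup>2"
  shows "form_bounded_by k D A"
  unfolding form_bounded_by_def
proof (intro ballI conjI)
  fix u assume u: "u \<in> cochains_fin V m k"
  show "l2_inner V m k (A u) u \<in> \<real>" by (simp add: real[OF u])
  have "ereal (q u) \<le> enn2ereal D * ereal ((l2_norm V m k u)\<^sup>2)"
  proof (cases D)
    case (real d)
    then show ?thesis using le[OF u] by (simp add: enn2ereal_ennreal)
  next
    case top
    show ?thesis
    proof (cases "l2_norm V m k u = 0")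
      case True
      then have "u = (\<lambda>\<sigma>. 0)"
        by (intro l2_norm_le_zero_imp[OF fin_l2[OF u]]) simp
      then have "of_real (q u) = (0 :: complex)"
        by (subst real[OF u, symmetric]) (simp add: l2_inner_def)
      then show ?thesis using True by (simp add: zero_ereal_def[symmetric])
    next
      case False
      then show ?thesis by (simp add: top enn2ereal_top)
    qed
  qed
  then show "ereal (Re (l2_inner V m k (A u) u)) \<le> enn2ereal D * ereal ((l2_norm V m k u)\<^sup>2)"
    by (simp add: real[OF u])
qed

lemma form_bounded_by_add:
  assumes A: "form_bounded_by k C A" and B: "form_bounded_by k D B"
  shows "form_bounded_by k (C + D) (\<lambda>u \<sigma>. A u \<sigma> + B u \<sigma>)"
  unfolding form_bounded_by_def
proof (intro ballI)
  fix u assume u: "u \<in> cochains_fin V m k"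
  let ?a = "l2_inner V m k (A u) u" and ?b = "l2_inner V m k (B u) u" and ?N = "ereal ((l2_norm V m k u)\<^sup>2)"
  have sum: "l2_inner V m k (\<lambda>\<sigma>. A u \<sigma> + B u \<sigma>) u = ?a + ?b"
    by (rule l2_inner_add) (auto intro!: fin_summable[OF u])
  have "ereal (Re (?a + ?b)) = ereal (Re ?a) + ereal (Re ?b)" by simp
  also have "\<dots> \<le> enn2ereal C * ?N + enn2ereal D * ?N"
    using A B u unfolding form_bounded_by_def by (intro add_mono) auto
  also have "\<dots> = enn2ereal (C + D) * ?N"
    unfolding plus_ennreal.rep_eq by (rule ereal_left_distrib[symmetric]) auto
  finally show "l2_inner V m k (\<lambda>\<sigma>. A u \<sigma> + B u \<sigma>) u \<in> \<real> \<and>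
     ereal (Re (l2_inner V m k (\<lambda>\<sigma>. A u \<sigma> + B u \<sigma>) u)) \<le> enn2ereal (C + D) * ?N"
    using A B u unfolding sum form_bounded_by_def by auto
qed

lemma form_bounded_by_zero: "form_bounded_by k D (\<lambda>u \<sigma>. 0)"
  by (rule form_bounded_byI[where q = "\<lambda>u. 0"]) (simp_all add: l2_inner_def)

lemma LL_down_form_bound:
  assumes k: "k \<le> n"
  shows "form_bounded_by k (deg_down V m k) (LL_down V n m k)"
proof (cases k)
  case 0
  then show ?thesis
    using form_bounded_by_zero[of 0] LL_down_0 by (simp add: form_bounded_by_def)
next
  case (Suc r)
  then have r: "r < n" using k by simp
  show ?thesis
    unfolding Suc
  proof (rule form_bounded_byI[OF LL_down_form[OF r]])
    fix u assume "u \<in> cochains_fin V m (Suc r)" "deg_down V m (Suc r) < \<infinity>"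
    then show "(l2_norm V m r (wdelta r u))\<^sup>2 \<le> enn2real (deg_down V m (Suc r)) * (l2_norm V m (Suc r) u)\<^sup>2"
      using wdelta_norm[OF r upper_degree_le_deg_up[OF r]] by (simp add: deg_down_Suc[OF r] fin_l2)
  qed
qed

lemma LL_up_form_bound:
  assumes k: "k \<le> n"
  shows "form_bounded_by k (deg_up V n m k) (LL_up V n m k)"
proof (cases "k = n")
  case True
  then show ?thesis
    using form_bounded_by_zero[of n] LL_up_top by (simp add: form_bounded_by_def)
next
  case False
  then have k': "k < n" using k by simp
  show ?thesis
  proof (rule form_bounded_byI[OF LL_up_form[OF k']])
    fix u assume "u \<in> cochains_fin V m k" "deg_up V n m k < \<infinity>"
    then show "(l2_norm V m (Suc k) (wcoboundary k u))\<^sup>2 \<le> enn2real (deg_up V n m k) * (l2_norm V m k u)\<^sup>2"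
      using wcoboundary_norm[OF k' upper_degree_le_deg_up[OF k']] by (simp add: fin_l2)
  qed
qed

lemma LL_down_bounded:
  assumes k: "k \<le> n" and fin: "deg_down V m k < \<infinity>"
  shows "symmetric_bounded_by k (enn2real (deg_down V m k)) (LL_down V n m k)"
proof (cases k)
  case 0
  moreover have "LL_down V n m 0 = (\<lambda>u \<sigma>. 0)"
    using LL_down_0 by blast
  ultimately show ?thesis
    using symmetric_bounded_by_zero[of 0] by (simp add: deg_down_def)
next
  case (Suc r)
  then have r: "r < n" using k by simp
  show ?thesis
    using fin symmetric_bounded_by_LL_down[OF r upper_degree_le_deg_up[OF r]] by (simp add: Suc deg_down_Suc[OF r])
qed

lemma LL_up_bounded:
  assumes k: "k \<le> n" and fin: "deg_up V n m k < \<infinity>"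
  shows "symmetric_bounded_by k (enn2real (deg_up V n m k)) (LL_up V n m k)"
proof (cases "k = n")
  case True
  moreover have "LL_up V n m n = (\<lambda>u \<sigma>. 0)"
    using LL_up_top by blast
  ultimately show ?thesis
    using symmetric_bounded_by_zero[of n] by (simp add: deg_up_def)
next
  case False
  then have k': "k < n" using k by simp
  show ?thesis
    using fin symmetric_bounded_by_LL_up[OF k' upper_degree_le_deg_up[OF k']] by simp
qed

section \<open>The self-adjoint extension\<close>

lemma Delta_tilde_bounded:
  assumes k: "k \<le> n" and fin: "deg_down V m k + deg_up V n m k < \<infinity>"
  shows "symmetric_bounded_by k (enn2real (deg_down V m k + deg_up V n m k)) (Delta_tilde V n m k)"
proof -
  have "deg_down V m k < \<infinity>" "deg_up V n m k < \<infinity>" using fin by auto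
  moreover have "Delta_tilde V n m k = (\<lambda>u \<sigma>. LL_down V n m k u \<sigma> + LL_up V n m k u \<sigma>)"
    by (simp add: Delta_tilde_def fun_eq_iff)
  ultimately show ?thesis
    using symmetric_bounded_by_add[OF LL_down_bounded[OF k] LL_up_bounded[OF k]]
    by (simp add: enn2real_plus)
qed

lemma symmetric_bounded_by_imp_bounded_op:
  assumes "symmetric_bounded_by k D A"
  shows "l2_bounded_op V m k A"
  using assms unfolding symmetric_bounded_by_def l2_bounded_op_def by blast

lemma symmetric_bounded_by_imp_op_norm_le:
  assumes A: "symmetric_bounded_by k D A" and D: "0 \<le> D"
  shows "l2_op_norm V m k A \<le> D"
  unfolding l2_op_norm_def
proof (rule cSUP_least)
  show "{f \<in> l2_space V m k. l2_norm V m k f \<le> 1} \<noteq> {}"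
    using zero_l2[of k] by force
  fix f assume "f \<in> {f \<in> l2_space V m k. l2_norm V m k f \<le> 1}"
  then have f: "f \<in> l2_space V m k" "l2_norm V m k f \<le> 1" by auto
  then have "l2_norm V m k (A f) \<le> D * l2_norm V m k f"
    using A by (simp add: symmetric_bounded_by_def)
  also have "\<dots> \<le> D * 1"
    using f D by (intro mult_left_mono)
  finally show "l2_norm V m k (A f) \<le> D" by simp
qed

end

theorem lemma4p9:
  fixes V :: "'v set" and n k :: nat and m :: "nat \<Rightarrow> 'v list \<Rightarrow> real"
  assumes complex: "weighted_flag_complex V n m"
    and k_le_n: "k \<le> n"
  shows
    "(\<forall>u\<in>cochains_fin V m k.
        (l2_inner V m k (LL_down V n m k u) u \<in> \<real> \<and>
         ereal (Re (l2_inner V m k (LL_down V n m k u) u))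
           \<le> enn2ereal (deg_down V m k) * ereal ((l2_norm V m k u)\<^sup>2)) \<and>
        (l2_inner V m k (LL_up V n m k u) u \<in> \<real> \<and>
         ereal (Re (l2_inner V m k (LL_up V n m k u) u))
           \<le> enn2ereal (deg_up V n m k) * ereal ((l2_norm V m k u)\<^sup>2)) \<and>
        (l2_inner V m k (Delta_tilde V n m k u) u \<in> \<real> \<and>
         ereal (Re (l2_inner V m k (Delta_tilde V n m k u) u))
           \<le> enn2ereal (deg_down V m k + deg_up V n m k) * ereal ((l2_norm V m k u)\<^sup>2))) \<and>
     (deg_down V m k + deg_up V n m k < \<infinity> \<longrightarrow>
        (\<forall>u\<in>cochains_fin V m k. Delta_tilde V n m k u \<in> l2_space V m k) \<and>
        (\<exists>C. \<forall>u\<in>cochains_fin V m k.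
           l2_norm V m k (Delta_tilde V n m k u) \<le> C * l2_norm V m k u) \<and>
        (\<exists>A. l2_bounded_op V m k A \<and>
             (\<forall>u\<in>cochains_fin V m k. A u = Delta_tilde V n m k u) \<and>
             (\<forall>B. l2_bounded_op V m k B \<and>
                  (\<forall>u\<in>cochains_fin V m k. B u = Delta_tilde V n m k u) \<longrightarrow>
                  (\<forall>f\<in>l2_space V m k. B f = A f)) \<and>
             l2_self_adjoint V m k A \<and>
             ereal (l2_op_norm V m k A) \<le> enn2ereal (deg_down V m k + deg_up V n m k)))"
proof -
  interpret weighted_flag_complex V n m by (rule complex)
  let ?A = "Delta_tilde V n m k" and ?D = "deg_down V m k + deg_up V n m k"
  note down = LL_down_form_bound[OF k_le_n] and up = LL_up_form_bound[OF k_le_n]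
  have "form_bounded_by k ?D ?A"
    using form_bounded_by_add[OF down up] by (simp add: form_bounded_by_def Delta_tilde_def)
  with down up have forms: "\<forall>u\<in>cochains_fin V m k.
        (l2_inner V m k (LL_down V n m k u) u \<in> \<real> \<and>
         ereal (Re (l2_inner V m k (LL_down V n m k u) u))
           \<le> enn2ereal (deg_down V m k) * ereal ((l2_norm V m k u)\<^sup>2)) \<and>
        (l2_inner V m k (LL_up V n m k u) u \<in> \<real> \<and>
         ereal (Re (l2_inner V m k (LL_up V n m k u) u))
           \<le> enn2ereal (deg_up V n m k) * ereal ((l2_norm V m k u)\<^sup>2)) \<and>
        (l2_inner V m k (?A u) u \<in> \<real> \<and>
         ereal (Re (l2_inner V m k (?A u) u)) \<le> enn2ereal ?D * ereal ((l2_norm V m k u)\<^sup>2))"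
    unfolding form_bounded_by_def by blast
  \<comment> \<open>The pointwise formula makes sense on all of \<open>\<ell>\<^sup>2\<close>, and so \<open>?A\<close> serves as its own extension.\<close>
  have ext: "(\<forall>u\<in>cochains_fin V m k. ?A u \<in> l2_space V m k) \<and>
      (\<exists>C. \<forall>u\<in>cochains_fin V m k. l2_norm V m k (?A u) \<le> C * l2_norm V m k u) \<and>
      (\<exists>A. l2_bounded_op V m k A \<and>
         (\<forall>u\<in>cochains_fin V m k. A u = ?A u) \<and>
         (\<forall>B. l2_bounded_op V m k B \<and> (\<forall>u\<in>cochains_fin V m k. B u = ?A u) \<longrightarrow>
              (\<forall>f\<in>l2_space V m k. B f = A f)) \<and>
         l2_self_adjoint V m k A \<and>
         ereal (l2_op_norm V m k A) \<le> enn2ereal ?D)" if fin: "?D < \<infinity>"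
  proof -
    note A = Delta_tilde_bounded[OF k_le_n fin]
    note bd = symmetric_bounded_by_imp_bounded_op[OF A]
    have "ereal (l2_op_norm V m k ?A) \<le> ereal (enn2real ?D)"
      using symmetric_bounded_by_imp_op_norm_le[OF A] by simp
    also have "\<dots> = enn2ereal (ennreal (enn2real ?D))"
      by (simp only: enn2ereal_ennreal[OF enn2real_nonneg])
    also have "ennreal (enn2real ?D) = ?D"
      using fin by (intro ennreal_enn2real) simp
    finally have "ereal (l2_op_norm V m k ?A) \<le> enn2ereal ?D" .
    moreover have "l2_self_adjoint V m k ?A"
      using A by (simp add: symmetric_bounded_by_def)
    moreover have "\<forall>B. l2_bounded_op V m k B \<and> (\<forall>u\<in>cochains_fin V m k. B u = ?A u) \<longrightarrow>
              (\<forall>f\<in>l2_space V m k. B f = ?A f)"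
      using bounded_op_unique[OF bd] by blast
    moreover have "\<forall>u\<in>cochains_fin V m k. ?A u \<in> l2_space V m k \<and>
        l2_norm V m k (?A u) \<le> enn2real ?D * l2_norm V m k u"
      using A fin_l2 unfolding symmetric_bounded_by_def by blast
    ultimately show ?thesis
      using bd by blast
  qed
  show ?thesis
    using forms ext by blast
qed

end
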